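(* Let $M$ be a regular $(K,K_{\mathrm{II}})$-Weingarten canal surface in $\mathbb{R}^3$. Then $M$ is one of the following: (i) a surface of revolution; (ii) a canal surface with radius $r(s)=c_1s+c_2$, $c_1\neq\pm1$, and with center curve whose curvature is $\kappa=\dfrac{c_3}{r^{1/3}}$, where $c_1,c_2,c_3$ are real constants; (iii) a tubular surface whose center curve is a cylindrical helix.
   Context: A canal surface in $\mathbb{R}^3$ is the envelope of a 1-parameter family of spheres; the curve $\alpha$ formed by the centers of the spheres is its center curve and $r(s)$, the radius of the sphere centered at $\alpha(s)$, is its radius. For a unit speed center curve $\alpha:I\to\mathbb{R}^3$ with Frenet frame $T,N,B$, curvature $\kappa$ and torsion $\tau$ (if $\alpha$ is a straight line, $\kappa=0$ and $T,N,B$ is a constant orthonormal frame), the canal surface is parametrized by $$C(s,t)=\alpha(s)-R(s)T-Q(s)\cos(t)N+Q(s)\sin(t)B,\qquad R=rr',\quad Q=\pm r\sqrt{1-r'^2}.$$ Regular means that the first fundamental form is nondegenerate. Within this class, a tubular surface (tube) is a canal surface with constant radius $r$; a surface of revolution is a canal surface whose center curve is a straight line ($\kappa=0$). With $E=\langle C_s,C_s\rangle$, $F=\langle C_s,C_t\rangle$, $G=\langle C_t,C_t\rangle$, $n$ a unit normal, $e=\langle C_{ss},n\rangle$, $f=\langle C_{st},n\rangle$, $g=\langle C_{tt},n\rangle$, the Gaussian curvature is $K=\frac{eg-f^2}{EG-F^2}$. When the second fundamental form $\mathrm{II}$ is nondegenerate, the second Gaussian curvature $K_{\mathrm{II}}$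 (the Gaussian curvature of $\mathrm{II}$ regarded as a (pseudo-)Riemannian metric) is $$K_{\mathrm{II}}=\frac{1}{(|eg|-f^2)^2}\left\{\begin{vmatrix}-\frac12e_{tt}+f_{st}-\frac12g_{ss}&\frac12e_s&f_s-\frac12e_t\\ f_t-\frac12g_s&e&f\\ \frac12g_t&f&g\end{vmatrix}-\begin{vmatrix}0&\frac12e_t&\frac12g_s\\ \frac12e_t&e&f\\ \frac12g_s&f&g\end{vmatrix}\right\}.$$ Whenever $K_{\mathrm{II}}$ is mentioned, $\mathrm{II}$ is assumed nondegenerate. The surface is called $(X,Y)$-Weingarten if the Jacobi function $\Phi(X,Y)=X_sY_t-X_tY_s$ vanishes identically. *)

theory Defs
  imports "HOL-Analysis.Analysis"
begin

definition smooth_on_interval :: "real set \<Rightarrow> (real \<Rightarrow> 'a::real_normed_vector) \<Rightarrow> bool" where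
  "smooth_on_interval I f \<longleftrightarrow>
     (\<forall>k. \<forall>s\<in>I. ((\<lambda>g u. vector_derivative g (at u)) ^^ k) f differentiable (at s))"

definition partial_s :: "(real \<Rightarrow> real \<Rightarrow> 'a::real_normed_vector) \<Rightarrow> real \<Rightarrow> real \<Rightarrow> 'a" where
  "partial_s X s t = vector_derivative (\<lambda>u. X u t) (at s)"

definition partial_t :: "(real \<Rightarrow> real \<Rightarrow> 'a::real_normed_vector) \<Rightarrow> real \<Rightarrow> real \<Rightarrow> 'a" where
  "partial_t X s t = vector_derivative (\<lambda>v. X s v) (at t)"

text \<open>The curvature either never vanishes, and the frame is the usual one, or the curve is a
  straight line, and the frame is any constant orthonormal frame starting with the tangent.
  The torsion is not needed below.\<close>

definition frenet_frame ::
  "real set \<Rightarrow> (real \<Rightarrow> real^3) \<Rightarrow> (real \<Rightarrow> real^3) \<Rightarrow> (real \<Rightarrow> real^3) \<Rightarrow> (real \<Rightarrow> real^3) \<Rightarrow> (real \<Rightarrow> real) \<Rightarrow> bool"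
where
  "frenet_frame I \<alpha> T N B \<kappa> \<longleftrightarrow>
     (\<forall>s\<in>I. T s = vector_derivative \<alpha> (at s) \<and> norm (T s) = 1
          \<and> \<kappa> s = norm (vector_derivative T (at s))) \<and>
     ((\<forall>s\<in>I. \<kappa> s \<noteq> 0 \<and> N s = (1 / \<kappa> s) *\<^sub>R vector_derivative T (at s)
          \<and> B s = cross3 (T s) (N s))
      \<or> ((\<forall>s\<in>I. \<kappa> s = 0) \<and>
         (\<exists>N0 B0. norm N0 = 1 \<and> norm B0 = 1 \<and> N0 \<bullet> B0 = 0 \<and>
            (\<forall>s\<in>I. N s = N0 \<and> B s = B0 \<and> T s \<bullet> N0 = 0 \<and> T s \<bullet> B0 = 0))))"

text \<open>The bound on \<open>r'\<close> is what makes \<open>Q\<close> real; \<open>\<epsilon>\<close> is the sign in the definition of \<open>Q\<close>.\<close>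

definition canal_surface ::
  "real set \<Rightarrow> (real \<Rightarrow> real^3) \<Rightarrow> (real \<Rightarrow> real) \<Rightarrow>
   (real \<Rightarrow> real^3) \<Rightarrow> (real \<Rightarrow> real^3) \<Rightarrow> (real \<Rightarrow> real^3) \<Rightarrow> (real \<Rightarrow> real) \<Rightarrow>
   (real \<Rightarrow> real \<Rightarrow> real^3) \<Rightarrow> bool"
where
  "canal_surface I \<alpha> r T N B \<kappa> C \<longleftrightarrow>
     open I \<and> is_interval I \<and>
     smooth_on_interval I \<alpha> \<and> frenet_frame I \<alpha> T N B \<kappa> \<and>
     smooth_on_interval I r \<and> (\<forall>s\<in>I. r s > 0 \<and> \<bar>deriv r s\<bar> \<le> 1) \<and>
     (\<exists>\<epsilon>\<in>{1, -1}. \<forall>s\<in>I. \<forall>t.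
        let R = r s * deriv r s; Q = \<epsilon> * r s * sqrt (1 - (deriv r s)\<^sup>2)
        in C s t = \<alpha> s - R *\<^sub>R T s - (Q * cos t) *\<^sub>R N s + (Q * sin t) *\<^sub>R B s)"

definition ff_E :: "(real \<Rightarrow> real \<Rightarrow> real^3) \<Rightarrow> real \<Rightarrow> real \<Rightarrow> real" where
  "ff_E C s t = partial_s C s t \<bullet> partial_s C s t"

definition ff_F :: "(real \<Rightarrow> real \<Rightarrow> real^3) \<Rightarrow> real \<Rightarrow> real \<Rightarrow> real" where
  "ff_F C s t = partial_s C s t \<bullet> partial_t C s t"

definition ff_G :: "(real \<Rightarrow> real \<Rightarrow> real^3) \<Rightarrow> real \<Rightarrow> real \<Rightarrow> real" where
  "ff_G C s t = partial_t C s t \<bullet> partial_t C s t"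

text \<open>The opposite choice of unit normal leaves \<open>K\<close> unchanged and changes the sign of \<open>K\<^sub>I\<^sub>I\<close>,
  so it does not affect the vanishing of the Jacobi function.\<close>

definition unit_normal :: "(real \<Rightarrow> real \<Rightarrow> real^3) \<Rightarrow> real \<Rightarrow> real \<Rightarrow> real^3" where
  "unit_normal C s t = sgn (cross3 (partial_s C s t) (partial_t C s t))"

definition sf_e :: "(real \<Rightarrow> real \<Rightarrow> real^3) \<Rightarrow> real \<Rightarrow> real \<Rightarrow> real" where
  "sf_e C s t = partial_s (partial_s C) s t \<bullet> unit_normal C s t"

definition sf_f :: "(real \<Rightarrow> real \<Rightarrow> real^3) \<Rightarrow> real \<Rightarrow> real \<Rightarrow> real" where
  "sf_f C s t = partial_t (partial_s C) s t \<bullet> unit_normal C s t"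

definition sf_g :: "(real \<Rightarrow> real \<Rightarrow> real^3) \<Rightarrow> real \<Rightarrow> real \<Rightarrow> real" where
  "sf_g C s t = partial_t (partial_t C) s t \<bullet> unit_normal C s t"

definition regular_on :: "(real \<times> real) set \<Rightarrow> (real \<Rightarrow> real \<Rightarrow> real^3) \<Rightarrow> bool" where
  "regular_on D C \<longleftrightarrow> (\<forall>(s, t)\<in>D. ff_E C s t * ff_G C s t - (ff_F C s t)\<^sup>2 \<noteq> 0)"

definition II_nondegenerate_on :: "(real \<times> real) set \<Rightarrow> (real \<Rightarrow> real \<Rightarrow> real^3) \<Rightarrow> bool" where
  "II_nondegenerate_on D C \<longleftrightarrow> (\<forall>(s, t)\<in>D. sf_e C s t * sf_g C s t - (sf_f C s t)\<^sup>2 \<noteq> 0)"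

definition gaussian_curvature :: "(real \<Rightarrow> real \<Rightarrow> real^3) \<Rightarrow> real \<Rightarrow> real \<Rightarrow> real" where
  "gaussian_curvature C s t =
     (sf_e C s t * sf_g C s t - (sf_f C s t)\<^sup>2) / (ff_E C s t * ff_G C s t - (ff_F C s t)\<^sup>2)"

definition second_gaussian_curvature :: "(real \<Rightarrow> real \<Rightarrow> real^3) \<Rightarrow> real \<Rightarrow> real \<Rightarrow> real" where
  "second_gaussian_curvature C s t =
    (let e = sf_e C s t; f = sf_f C s t; g = sf_g C s t;
         e_s = partial_s (sf_e C) s t; e_t = partial_t (sf_e C) s t;
         f_s = partial_s (sf_f C) s t; f_t = partial_t (sf_f C) s t;
         g_s = partial_s (sf_g C) s t; g_t = partial_t (sf_g C) s t;
         e_tt = partial_t (partial_t (sf_e C)) s t;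
         f_st = partial_t (partial_s (sf_f C)) s t;
         g_ss = partial_s (partial_s (sf_g C)) s t
     in 1 / (\<bar>e * g\<bar> - f\<^sup>2)\<^sup>2 *
        (det (vector [vector [- (1/2) * e_tt + f_st - (1/2) * g_ss, (1/2) * e_s, f_s - (1/2) * e_t],
                      vector [f_t - (1/2) * g_s, e, f],
                      vector [(1/2) * g_t, f, g]] :: real^3^3)
         - det (vector [vector [0, (1/2) * e_t, (1/2) * g_s],
                        vector [(1/2) * e_t, e, f],
                        vector [(1/2) * g_s, f, g]] :: real^3^3)))"

text \<open>If \<open>II\<close> is indefinite, the denominator \<open>|eg| - f\<^sup>2\<close> in \<open>K\<^sub>I\<^sub>I\<close> may vanish even though
  \<open>eg - f\<^sup>2\<close> does not; such points are excluded here.\<close>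

definition second_gaussian_curvature_domain ::
  "(real \<times> real) set \<Rightarrow> (real \<Rightarrow> real \<Rightarrow> real^3) \<Rightarrow> (real \<times> real) set"
where
  "second_gaussian_curvature_domain D C =
     {(s, t) \<in> D. \<bar>sf_e C s t * sf_g C s t\<bar> - (sf_f C s t)\<^sup>2 \<noteq> 0}"

definition jacobi_function ::
  "(real \<Rightarrow> real \<Rightarrow> real) \<Rightarrow> (real \<Rightarrow> real \<Rightarrow> real) \<Rightarrow> real \<Rightarrow> real \<Rightarrow> real"
where
  "jacobi_function X Y s t = partial_s X s t * partial_t Y s t - partial_t X s t * partial_s Y s t"

definition weingarten_on ::
  "(real \<times> real) set \<Rightarrow> (real \<Rightarrow> real \<Rightarrow> real) \<Rightarrow> (real \<Rightarrow> real \<Rightarrow> real) \<Rightarrow> bool"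
where
  "weingarten_on S X Y \<longleftrightarrow> (\<forall>(s, t)\<in>S. jacobi_function X Y s t = 0)"

definition straight_line_on :: "real set \<Rightarrow> (real \<Rightarrow> real^3) \<Rightarrow> bool" where
  "straight_line_on I \<alpha> \<longleftrightarrow> (\<exists>a v. \<forall>s\<in>I. \<alpha> s = a + s *\<^sub>R v)"

definition cylindrical_helix_on :: "real set \<Rightarrow> (real \<Rightarrow> real^3) \<Rightarrow> bool" where
  "cylindrical_helix_on I \<alpha> \<longleftrightarrow>
     (\<exists>u c. norm u = 1 \<and> (\<forall>s\<in>I. vector_derivative \<alpha> (at s) \<bullet> u = c))"

end

theory Submission
  imports Defs "HOL-Computational_Algebra.Polynomial"
begin

text \<open>Let \<open>p = 1 - r'\<^sup>2\<close>; regularity forces \<open>p > 0\<close>. If \<open>\<kappa>\<close> vanishes, the tangent is constant and the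
center curve is a line. Otherwise \<open>\<kappa>\<close> vanishes nowhere, and the claim proved below is that \<open>r\<close> and \<open>\<kappa>\<close>
are both constant, which is the second alternative of the theorem with \<open>c\<^sub>1 = 0\<close>.

The vector \<open>(C - \<alpha>) / r\<close> is a unit normal. With \<open>Q = r q\<close>, \<open>\<nu> = r q \<kappa> / p\<close>, \<open>\<omega> = r r'' / p\<close> and
\<open>z = \<nu> cos t - \<omega>\<close>, \<open>S = \<nu> sin t\<close>, \<open>y = r' S + r \<tau>\<close>
the second fundamental form is, up to sign,
\<open>- (p / r) ((z + z\<^sup>2) ds\<^sup>2 + (y ds - r dt)\<^sup>2)\<close>, and everything becomes algebraic in \<open>z\<close> and \<open>S\<close>:
\<open>K = z / (r\<^sup>2 (1 + z))\<close> and \<open>K\<^sub>I\<^sub>I = \<plusminus> H / (4 r J\<^sup>2)\<close>, where \<open>H = 4 z\<^sup>4 + 6 z\<^sup>3 + z\<^sup>2 + h\<^sub>1 z + h\<^sub>0 - h S\<close>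
has coefficients depending on \<open>s\<close> only (lemmas \<open>brioschi_numerator\<close>, \<open>H_eq\<close>). The absolute value in the
formula for \<open>K\<^sub>I\<^sub>I\<close> makes \<open>J\<close> depend on the sign of \<open>e g\<close>: it is \<open>z + z\<^sup>2\<close> where \<open>e g > 0\<close> and
\<open>z + z\<^sup>2 + 2 y\<^sup>2\<close> where \<open>e g < 0\<close>. A parameter \<open>l\<close>, equal to \<open>0\<close> or \<open>1\<close>, covers both cases.

Fix \<open>s\<close>. Up to a nonvanishing factor, the Jacobi function is \<open>A(z) + S B(z)\<close> with polynomials \<open>A\<close>, \<open>B\<close>
(lemma \<open>jacobi_polynomial\<close>). It vanishes for \<open>t\<close> in an interval, and \<open>S\<close> is a square root of a quadratic
polynomial in \<open>z\<close> with negative leading coefficient, so \<open>A = B = 0\<close> (lemma \<open>affine_trig_poly_eq_0\<close>). Every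
coefficient of \<open>A\<close> and \<open>B\<close> is then a differential equation in \<open>s\<close>.

  \<^item> If \<open>e g > 0\<close> somewhere on the slice, the coefficient of \<open>z\<^sup>5\<close> in \<open>B\<close> is \<open>2 r' / r\<close>, so \<open>r' = 0\<close>.

  \<^item> If \<open>e g < 0\<close> and \<open>r' \<noteq> 0\<close>, the coefficient of \<open>z\<^sup>7\<close> in \<open>A\<close> gives \<open>\<tau> = 0\<close>. Put \<open>X = r'\<^sup>2\<close>. The
    coefficients of \<open>z\<^sup>6\<close> and \<open>z\<^sup>5\<close> in \<open>B\<close> then express \<open>\<omega>\<close> and \<open>\<nu>\<^sup>2\<close> as rational functions of \<open>X\<close>, and the
    coefficient of \<open>z\<^sup>4\<close> becomes a polynomial equation for \<open>X\<close> with nonzero constant term. But \<open>X' \<noteq> 0\<close> by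
    the first of these relations, so \<open>X\<close> takes infinitely many values, a contradiction
    (lemma \<open>no_indefinite_family\<close>). At a parameter where \<open>J\<close> vanishes on the whole slice, nothing can be read
    off; there \<open>X = \<omega> = 1/2\<close>, and such parameters do not fill an open set.

Hence \<open>r' = 0\<close> throughout. For constant \<open>r\<close>, the coefficients of \<open>z\<^sup>4\<close>, \<open>z\<^sup>3\<close>, \<open>z\<^sup>2\<close> in \<open>B\<close> give \<open>\<nu>' = 0\<close>
whatever the sign of \<open>e g\<close> (lemma \<open>even_part_coeff_tube\<close>), and \<open>\<nu>\<close> is a constant multiple of \<open>\<kappa>\<close>.\<close>


section \<open>Functions with several derivatives\<close>

text \<open>The curvature, the torsion and the square root in \<open>Q\<close> are algebraic expressions in derivatives of \<open>\<alpha>\<close>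
and \<open>r\<close>. A notion of finite differentiability that is closed under these operations supplies their
derivatives as functions without computing them.\<close>

primrec times_differentiable_on ::
  "nat \<Rightarrow> real set \<Rightarrow> (real \<Rightarrow> 'a::real_normed_vector) \<Rightarrow> bool" where
  "times_differentiable_on 0 S f \<longleftrightarrow> True"
| "times_differentiable_on (Suc n) S f \<longleftrightarrow>
     (\<exists>f'. (\<forall>x\<in>S. (f has_vector_derivative f' x) (at x)) \<and> times_differentiable_on n S f')"

lemma times_differentiable_on_mono:
  "times_differentiable_on (Suc n) S f \<Longrightarrow> times_differentiable_on n S f"
proof (induction n arbitrary: f)
  case (Suc n)
  from Suc.prems obtain f' where "\<forall>x\<in>S. (f has_vector_derivative f' x) (at x)"
    and "times_differentiable_on (Suc n) S f'"
    unfolding times_differentiable_on.simps(2)[of "Suc n"] by blast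
  with Suc.IH[of f'] show ?case unfolding times_differentiable_on.simps(2)[of n] by blast
qed simp

lemma times_differentiable_on_cong:
  assumes "open S" "\<And>x. x \<in> S \<Longrightarrow> f x = g x" "times_differentiable_on n S f"
  shows "times_differentiable_on n S g"
proof (cases n)
  case (Suc m)
  with assms obtain f' where f': "\<forall>x\<in>S. (f has_vector_derivative f' x) (at x)"
    and "times_differentiable_on m S f'" by auto
  moreover have "(g has_vector_derivative f' x) (at x)" if "x \<in> S" for x
    by (rule has_vector_derivative_transform_within_open[of f _ _ S])
      (use f' that assms(1,2) in auto)
  ultimately show ?thesis unfolding Suc times_differentiable_on.simps by blast
qed auto

lemma times_differentiable_on_const: "times_differentiable_on n S (\<lambda>x. c)"
proof (induction n arbitrary: c)
  case (Suc n)
  have "\<forall>x\<in>S. ((\<lambda>x. c) has_vector_derivative 0) (at x)" by simp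
  with Suc[of 0] show ?case unfolding times_differentiable_on.simps by (intro exI conjI)
qed auto

lemma times_differentiable_on_add:
  "times_differentiable_on n S f \<Longrightarrow> times_differentiable_on n S g \<Longrightarrow>
   times_differentiable_on n S (\<lambda>x. f x + g x)"
proof (induction n arbitrary: f g)
  case (Suc n)
  then obtain f' g' where
    "\<forall>x\<in>S. (f has_vector_derivative f' x) (at x)" "times_differentiable_on n S f'"
    "\<forall>x\<in>S. (g has_vector_derivative g' x) (at x)" "times_differentiable_on n S g'" by auto
  then have "\<forall>x\<in>S. ((\<lambda>x. f x + g x) has_vector_derivative f' x + g' x) (at x)"
    and "times_differentiable_on n S (\<lambda>x. f' x + g' x)"
    using Suc.IH[of f' g'] by (simp_all add: has_vector_derivative_add)
  then show ?case unfolding times_differentiable_on.simps by (intro exI conjI)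
qed auto

lemma times_differentiable_on_bilinear:
  assumes "bounded_bilinear pr"
  shows "times_differentiable_on n S f \<Longrightarrow> times_differentiable_on n S g \<Longrightarrow>
   times_differentiable_on n S (\<lambda>x. pr (f x) (g x))"
proof (induction n arbitrary: f g)
  case (Suc n)
  then obtain f' g' where
    f: "\<forall>x\<in>S. (f has_vector_derivative f' x) (at x)" "times_differentiable_on n S f'" and
    g: "\<forall>x\<in>S. (g has_vector_derivative g' x) (at x)" "times_differentiable_on n S g'" by auto
  have "times_differentiable_on n S (\<lambda>x. pr (f x) (g' x) + pr (f' x) (g x))"
    by (intro times_differentiable_on_add Suc.IH f(2) g(2)
        times_differentiable_on_mono[OF Suc.prems(1)] times_differentiable_on_mono[OF Suc.prems(2)])
  moreover have "\<forall>x\<in>S. ((\<lambda>x. pr (f x) (g x)) has_vector_derivative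
      pr (f x) (g' x) + pr (f' x) (g x)) (at x)"
    using f g by (simp add: bounded_bilinear.has_vector_derivative[OF assms])
  ultimately show ?case unfolding times_differentiable_on.simps by (intro exI conjI)
qed auto

lemmas times_differentiable_on_mult = times_differentiable_on_bilinear[OF bounded_bilinear_mult]
lemmas times_differentiable_on_scaleR = times_differentiable_on_bilinear[OF bounded_bilinear_scaleR]
lemmas times_differentiable_on_inner = times_differentiable_on_bilinear[OF bounded_bilinear_inner]

lemma bounded_bilinear_cross3: "bounded_bilinear cross3"
  using bilinear_conv_bounded_bilinear bilinear_cross by blast

lemmas times_differentiable_on_cross3 = times_differentiable_on_bilinear[OF bounded_bilinear_cross3]

lemma times_differentiable_on_inverse:
  fixes f :: "real \<Rightarrow> real"
  assumes "\<And>x. x \<in> S \<Longrightarrow> f x \<noteq> 0"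
  shows "times_differentiable_on n S f \<Longrightarrow> times_differentiable_on n S (\<lambda>x. inverse (f x))"
proof (induction n)
  case (Suc n)
  then obtain f' where
    f: "\<forall>x\<in>S. (f has_vector_derivative f' x) (at x)" "times_differentiable_on n S f'" by auto
  have "times_differentiable_on n S (\<lambda>x. (-1) * (f' x * (inverse (f x) * inverse (f x))))"
    by (intro times_differentiable_on_mult times_differentiable_on_const f(2) Suc.IH
        times_differentiable_on_mono[OF Suc.prems(1)])
  moreover have "((\<lambda>x. inverse (f x)) has_vector_derivative
      (-1) * (f' x * (inverse (f x) * inverse (f x)))) (at x)" if "x \<in> S" for x
    using f that assms[OF that]
    by (auto simp: has_real_derivative_iff_has_vector_derivative[symmetric]
        intro!: derivative_eq_intros)
  ultimately show ?case unfolding times_differentiable_on.simps by (intro exI conjI ballI)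
qed auto

lemma times_differentiable_on_divide:
  fixes f g :: "real \<Rightarrow> real"
  assumes "\<And>x. x \<in> S \<Longrightarrow> g x \<noteq> 0"
    and "times_differentiable_on n S f" "times_differentiable_on n S g"
  shows "times_differentiable_on n S (\<lambda>x. f x / g x)"
  using times_differentiable_on_mult[OF assms(2) times_differentiable_on_inverse[OF assms(1,3)]]
  by (simp add: divide_inverse)

lemma times_differentiable_on_sqrt:
  fixes f :: "real \<Rightarrow> real"
  assumes "\<And>x. x \<in> S \<Longrightarrow> f x > 0"
  shows "times_differentiable_on n S f \<Longrightarrow> times_differentiable_on n S (\<lambda>x. sqrt (f x))"
proof (induction n)
  case (Suc n)
  then obtain f' where
    f: "\<forall>x\<in>S. (f has_vector_derivative f' x) (at x)" "times_differentiable_on n S f'" by auto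
  have "sqrt (f x) \<noteq> 0" if "x \<in> S" for x using assms[OF that] by simp
  note inv = times_differentiable_on_inverse[OF this]
  have "times_differentiable_on n S (\<lambda>x. (1/2) * (f' x * inverse (sqrt (f x))))"
    by (intro times_differentiable_on_mult times_differentiable_on_const f(2) inv Suc.IH
        times_differentiable_on_mono[OF Suc.prems(1)])
  moreover have "((\<lambda>x. sqrt (f x)) has_vector_derivative
      (1/2) * (f' x * inverse (sqrt (f x)))) (at x)" if "x \<in> S" for x
    using DERIV_chain2[where f = sqrt and g = f, OF DERIV_real_sqrt[OF assms[OF that]], of "f' x" UNIV] f that
    by (simp add: has_real_derivative_iff_has_vector_derivative[symmetric] mult_ac)
  ultimately show ?case unfolding times_differentiable_on.simps by (intro exI conjI ballI)
qed auto

lemma times_differentiable_on_iterated_derivative: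
  assumes "smooth_on_interval I f"
  shows "times_differentiable_on n I (((\<lambda>g u. vector_derivative g (at u)) ^^ k) f)"
proof (induction n arbitrary: k)
  case (Suc n)
  have "\<forall>x\<in>I. (((\<lambda>g u. vector_derivative g (at u)) ^^ k) f has_vector_derivative
     ((\<lambda>g u. vector_derivative g (at u)) ^^ Suc k) f x) (at x)"
    using assms by (auto simp: smooth_on_interval_def vector_derivative_works)
  with Suc[of "Suc k"] show ?case
    unfolding times_differentiable_on.simps by (intro exI conjI)
qed auto

section \<open>Trigonometric polynomials on an interval\<close>

text \<open>A connected finite set is a point, so otherwise \<open>cos\<close> and then \<open>sin\<close> would be constant on the interval,
which would make both vanish.\<close>

lemma infinite_image_cos:
  fixes a b :: real
  assumes "a < b"
  shows "infinite (cos ` {a<..<b})"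
proof
  assume fin: "finite (cos ` {a<..<b})"
  have "connected (cos ` {a<..<b})"
    by (intro connected_continuous_image continuous_intros) simp
  with fin have "cos ` {a<..<b} = {} \<or> (\<exists>c. cos ` {a<..<b} = {c})"
    using connected_finite_iff_sing by blast
  moreover have "cos ` {a<..<b} \<noteq> {}" using assms by simp
  ultimately obtain c where "cos ` {a<..<b} = {c}" by blast
  then have c: "cos t = c" if "t \<in> {a<..<b}" for t using that by blast
  have sin0: "sin t = 0" if "t \<in> {a<..<b}" for t
  proof -
    have "((\<lambda>t. c) has_real_derivative - sin t) (at t)"
      by (rule has_field_derivative_transform_within_open[of cos _ _ "{a<..<b}"])
        (use that c in \<open>auto intro!: derivative_eq_intros\<close>)
    then show ?thesis using DERIV_unique[OF _ DERIV_const] by fastforce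
  qed
  define m where "m = (a + b) / 2"
  have m: "m \<in> {a<..<b}" using assms by (auto simp: m_def)
  have "((\<lambda>t. 0) has_real_derivative cos m) (at m)"
    by (rule has_field_derivative_transform_within_open[of sin _ _ "{a<..<b}"])
      (use m sin0 in \<open>auto intro!: derivative_eq_intros\<close>)
  then have "cos m = 0" using DERIV_unique[OF _ DERIV_const] by fastforce
  with sin0[OF m] show False using sin_cos_squared_add[of m] by simp
qed

text \<open>The hypothesis makes \<open>A\<^sup>2 = (1 - x\<^sup>2) B\<^sup>2\<close> hold for infinitely many \<open>x\<close>, hence identically. The leading
coefficients then satisfy \<open>a\<^sup>2 = - b\<^sup>2\<close>, which over the reals forces both polynomials to be zero.\<close>

lemma trig_poly_eq_0:
  fixes A B :: "real poly"
  assumes "a < b" and eq: "\<And>t. t \<in> {a<..<b} \<Longrightarrow> poly A (cos t) + sin t * poly B (cos t) = 0"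
  shows "A = 0" "B = 0"
proof -
  have "poly (A * A - [:1, 0, -1:] * (B * B)) (cos t) = 0" if "t \<in> {a<..<b}" for t
  proof -
    have "poly A (cos t) = - (sin t * poly B (cos t))" using eq[OF that] by simp
    then have "poly A (cos t) * poly A (cos t) = (sin t)\<^sup>2 * (poly B (cos t) * poly B (cos t))"
      by (simp add: power2_eq_square)
    also have "(sin t)\<^sup>2 = 1 - cos t * cos t" by (simp only: sin_squared_eq) (simp add: power2_eq_square)
    finally show ?thesis by (simp del: mult_pCons_left add: algebra_simps)
  qed
  then have "cos ` {a<..<b} \<subseteq> {x. poly (A * A - [:1, 0, -1:] * (B * B)) x = 0}" by auto
  then have "infinite {x. poly (A * A - [:1, 0, -1:] * (B * B)) x = 0}"
    using infinite_image_cos[OF assms(1)] finite_subset by blast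
  then have AB: "A * A = [:1, 0, -1:] * (B * B)"
    using poly_roots_finite[of "A * A - [:1, 0, -1:] * (B * B)"] by auto
  have "lead_coeff A ^ 2 = - (lead_coeff B ^ 2)"
    using arg_cong[OF AB, of lead_coeff] by (simp add: lead_coeff_mult power2_eq_square del: mult_pCons_left)
  then have "lead_coeff A ^ 2 = 0 \<and> lead_coeff B ^ 2 = 0"
    using zero_le_power2[of "lead_coeff A"] zero_le_power2[of "lead_coeff B"] by linarith
  then show "A = 0" "B = 0" by auto
qed

text \<open>Version for an affine function of the cosine, the form in which \<open>z\<close> and \<open>S\<close> occur.\<close>

lemma affine_trig_poly_eq_0:
  fixes A B :: "real poly"
  assumes "a < b" "\<nu> \<noteq> 0"
    and eq: "\<And>t. t \<in> {a<..<b} \<Longrightarrow>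
      poly A (\<nu> * cos t - \<omega>) + \<nu> * sin t * poly B (\<nu> * cos t - \<omega>) = 0"
  shows "A = 0" "B = 0"
proof -
  let ?l = "[:-\<omega>, \<nu>:]"
  have "poly (pcompose A ?l) (cos t) + sin t * poly (smult \<nu> (pcompose B ?l)) (cos t) = 0"
    if "t \<in> {a<..<b}" for t
    using eq[OF that] by (simp add: poly_pcompose algebra_simps)
  from trig_poly_eq_0[OF assms(1) this] have "pcompose A ?l = 0" "pcompose B ?l = 0"
    using assms(2) by auto
  then show "A = 0" "B = 0" using assms(2) by (simp_all add: pcompose_eq_0)
qed

section \<open>The fundamental forms of a canal surface\<close>

lemma real_differentiableI: "(f has_real_derivative d) (at x) \<Longrightarrow> f differentiable (at x)"
  unfolding real_differentiable_def by blast

lemma vector_derivative_eq_on_open: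
  assumes "open I" "s \<in> I" "\<And>u. u \<in> I \<Longrightarrow> F u = G u" "(G has_vector_derivative d) (at s)"
  shows "vector_derivative F (at s) = d"
proof -
  have "(F has_vector_derivative d) (at s)"
    by (rule has_vector_derivative_transform_within_open[OF assms(4,1,2)]) (simp add: assms(3))
  then show ?thesis by (rule vector_derivative_at)
qed

text \<open>For the last claim, the difference of the two sides is orthogonal to the three frame vectors; it is
therefore both parallel and orthogonal to \<open>T \<times> N\<close>, and so it is zero.\<close>

lemma orthonormal_frame:
  fixes T N :: "real^3"
  assumes "T \<bullet> T = 1" "N \<bullet> N = 1" "T \<bullet> N = 0"
  shows "cross3 T N \<bullet> cross3 T N = 1"
    and "cross3 N (cross3 T N) = T" and "cross3 (cross3 T N) T = N"
    and "T \<bullet> cross3 T N = 0" "N \<bullet> cross3 T N = 0"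
    and "v = (v \<bullet> T) *\<^sub>R T + (v \<bullet> N) *\<^sub>R N + (v \<bullet> cross3 T N) *\<^sub>R cross3 T N"
proof -
  show 1: "cross3 T N \<bullet> cross3 T N = 1"
    using norm_cross[of T N] assms by (simp add: power2_norm_eq_inner)
  show 2: "T \<bullet> cross3 T N = 0" "N \<bullet> cross3 T N = 0" by (simp_all add: dot_cross_self)
  show "cross3 N (cross3 T N) = T" "cross3 (cross3 T N) T = N"
    using assms by (simp_all add: Lagrange cross_skew[of "cross3 T N"] inner_commute)
  define x where "x = v - ((v \<bullet> T) *\<^sub>R T + (v \<bullet> N) *\<^sub>R N + (v \<bullet> cross3 T N) *\<^sub>R cross3 T N)"
  have x: "x \<bullet> T = 0" "x \<bullet> N = 0" "x \<bullet> cross3 T N = 0"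
    using assms 1 2
    by (simp_all add: x_def inner_diff_left inner_diff_right inner_add_left inner_add_right inner_commute)
  then have "cross3 x (cross3 T N) = 0" by (simp add: Lagrange)
  with x(3) have "x = 0 \<or> cross3 T N = 0" using norm_and_cross_eq_0 by blast
  with 1 have "x = 0" by auto
  then show "v = (v \<bullet> T) *\<^sub>R T + (v \<bullet> N) *\<^sub>R N + (v \<bullet> cross3 T N) *\<^sub>R cross3 T N"
    by (simp add: x_def)
qed

text \<open>The function \<open>q\<close> stands for \<open>\<plusminus> sqrt (1 - r'\<^sup>2)\<close>. Only \<open>q\<^sup>2 = 1 - r'\<^sup>2\<close> and its derivative enter, so both
signs of \<open>Q = r q\<close> are treated at once.\<close>

locale framed_canal_surface =
  fixes I :: "real set" and \<alpha> T N B :: "real \<Rightarrow> real^3"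
    and r r1 r2 r3 q q1 q2 \<kappa> \<kappa>1 \<tau> \<tau>1 :: "real \<Rightarrow> real"
    and C :: "real \<Rightarrow> real \<Rightarrow> real^3"
  assumes open_I: "open I"
    and \<alpha>_deriv: "s \<in> I \<Longrightarrow> (\<alpha> has_vector_derivative T s) (at s)"
    and T_deriv: "s \<in> I \<Longrightarrow> (T has_vector_derivative \<kappa> s *\<^sub>R N s) (at s)"
    and N_deriv: "s \<in> I \<Longrightarrow> (N has_vector_derivative - \<kappa> s *\<^sub>R T s + \<tau> s *\<^sub>R B s) (at s)"
    and B_deriv: "s \<in> I \<Longrightarrow> (B has_vector_derivative - \<tau> s *\<^sub>R N s) (at s)"
    and TT: "s \<in> I \<Longrightarrow> T s \<bullet> T s = 1" and NN: "s \<in> I \<Longrightarrow> N s \<bullet> N s = 1"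
    and TN: "s \<in> I \<Longrightarrow> T s \<bullet> N s = 0" and B_eq: "s \<in> I \<Longrightarrow> B s = cross3 (T s) (N s)"
    and r_deriv: "s \<in> I \<Longrightarrow> (r has_real_derivative r1 s) (at s)"
    and r1_deriv: "s \<in> I \<Longrightarrow> (r1 has_real_derivative r2 s) (at s)"
    and r2_deriv: "s \<in> I \<Longrightarrow> (r2 has_real_derivative r3 s) (at s)"
    and q_deriv: "s \<in> I \<Longrightarrow> (q has_real_derivative q1 s) (at s)"
    and q1_deriv: "s \<in> I \<Longrightarrow> (q1 has_real_derivative q2 s) (at s)"
    and \<kappa>_deriv: "s \<in> I \<Longrightarrow> (\<kappa> has_real_derivative \<kappa>1 s) (at s)"
    and \<tau>_deriv: "s \<in> I \<Longrightarrow> (\<tau> has_real_derivative \<tau>1 s) (at s)"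
    and r_pos: "s \<in> I \<Longrightarrow> r s > 0"
    and q_nonzero: "s \<in> I \<Longrightarrow> q s \<noteq> 0" and q_squared: "s \<in> I \<Longrightarrow> q s * q s = 1 - (r1 s)\<^sup>2"
    and q_q1: "s \<in> I \<Longrightarrow> q s * q1 s = - r1 s * r2 s"
    and C_eq: "s \<in> I \<Longrightarrow> C s t = \<alpha> s - (r s * r1 s) *\<^sub>R T s - (r s * q s * cos t) *\<^sub>R N s
          + (r s * q s * sin t) *\<^sub>R B s"
begin

definition vec where "vec s a b c = a *\<^sub>R T s + b *\<^sub>R N s + c *\<^sub>R B s"

lemma vec_cong: "a = a' \<Longrightarrow> b = b' \<Longrightarrow> c = c' \<Longrightarrow> vec s a b c = vec s a' b' c'"
  by simp

lemma vec_inner: 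
  assumes "s \<in> I"
  shows "vec s a b c \<bullet> vec s a' b' c' = a * a' + b * b' + c * c'"
  using orthonormal_frame(1,4,5)[OF TT[OF assms] NN[OF assms] TN[OF assms]] TT[OF assms] NN[OF assms] TN[OF assms]
  unfolding vec_def B_eq[OF assms]
  by (simp add: inner_add_left inner_add_right inner_commute)

lemma vec_cross:
  assumes "s \<in> I"
  shows "cross3 (vec s a b c) (vec s a' b' c') = vec s (b * c' - c * b') (c * a' - a * c') (a * b' - b * a')"
proof -
  have TN': "cross3 (T s) (N s) = B s" "cross3 (N s) (B s) = T s" "cross3 (B s) (T s) = N s"
    using orthonormal_frame(2,3)[OF TT[OF assms] NN[OF assms] TN[OF assms]] by (simp_all add: B_eq[OF assms])
  then have "cross3 (N s) (T s) = - B s" "cross3 (B s) (N s) = - T s" "cross3 (T s) (B s) = - N s"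
    by (metis cross_skew)+
  with TN' show ?thesis
    unfolding vec_def
    by (simp add: cross_add_left cross_add_right cross_mult_left cross_mult_right algebra_simps)
qed

lemma vec_deriv:
  assumes s: "s \<in> I" and "(a has_real_derivative a') (at s)" "(b has_real_derivative b') (at s)"
    "(c has_real_derivative c') (at s)"
  shows "((\<lambda>u. vec u (a u) (b u) (c u)) has_vector_derivative
     vec s (a' - \<kappa> s * b s) (\<kappa> s * a s + b' - \<tau> s * c s) (c' + \<tau> s * b s)) (at s)"
  unfolding vec_def
  by (rule has_vector_derivative_eq_rhs,
      (rule has_vector_derivative_add has_vector_derivative_scaleR assms T_deriv[OF s] N_deriv[OF s] B_deriv[OF s])+)
    (simp add: algebra_simps)

lemma vec_deriv_t:
  assumes "(a has_real_derivative a') (at t)" "(b has_real_derivative b') (at t)"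
    "(c has_real_derivative c') (at t)"
  shows "((\<lambda>v. vec s (a v) (b v) (c v)) has_vector_derivative vec s a' b' c') (at t)"
  unfolding vec_def
  by (rule has_vector_derivative_eq_rhs,
      (rule has_vector_derivative_add has_vector_derivative_scaleR assms has_vector_derivative_const)+)
    simp

text \<open>Here \<open>Cs\<close> and \<open>Ct\<close> are the two partial derivatives of \<open>C\<close> in the frame, and \<open>nn\<close> is \<open>(C - \<alpha>) / r\<close>.
The quantity \<open>QP\<close> is \<open>p + r P\<close> for \<open>p = 1 - r'\<^sup>2\<close>; the surface is regular exactly where it is nonzero.\<close>

definition P where "P s t = q s * \<kappa> s * cos t - r2 s"
definition QP where "QP s t = 1 - (r1 s)\<^sup>2 + r s * P s t"
definition bs where "bs s t = - \<kappa> s * r s * r1 s - (r1 s * q s + r s * q1 s) * cos t - \<tau> s * r s * q s * sin t"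
definition cs where "cs s t = (r1 s * q s + r s * q1 s) * sin t - \<tau> s * r s * q s * cos t"

definition Cs where "Cs s t = vec s (QP s t) (bs s t) (cs s t)"
definition Ct where "Ct s t = vec s 0 (r s * q s * sin t) (r s * q s * cos t)"
definition nn where "nn s t = vec s (- r1 s) (- q s * cos t) (q s * sin t)"

lemmas scalar_derivs = r_deriv r1_deriv r2_deriv q_deriv q1_deriv \<kappa>_deriv \<tau>_deriv

lemma C_vec: "s \<in> I \<Longrightarrow> C s t = \<alpha> s + vec s (- r s * r1 s) (- r s * q s * cos t) (r s * q s * sin t)"
  by (simp add: C_eq vec_def)

lemma partial_s_C:
  assumes s: "s \<in> I" shows "partial_s C s t = Cs s t"
  unfolding partial_s_def
proof (rule vector_derivative_eq_on_open[OF open_I s C_vec])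
  have d: "((\<lambda>u. - r u * r1 u) has_real_derivative - (r1 s * r1 s + r s * r2 s)) (at s)"
      "((\<lambda>u. - r u * q u * cos t) has_real_derivative - (r1 s * q s + r s * q1 s) * cos t) (at s)"
      "((\<lambda>u. r u * q u * sin t) has_real_derivative (r1 s * q s + r s * q1 s) * sin t) (at s)"
    by (auto intro!: derivative_eq_intros scalar_derivs s simp: algebra_simps)
  have Tv: "T s + vec s a b c = vec s (1 + a) b c" for a b c
    by (simp add: vec_def algebra_simps)
  have "T s + vec s (- (r1 s * r1 s + r s * r2 s) - \<kappa> s * (- r s * q s * cos t))
       (\<kappa> s * (- r s * r1 s) + - (r1 s * q s + r s * q1 s) * cos t - \<tau> s * (r s * q s * sin t))
       ((r1 s * q s + r s * q1 s) * sin t + \<tau> s * (- r s * q s * cos t)) = Cs s t"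
    unfolding Tv Cs_def
    by (rule vec_cong) (simp_all add: QP_def P_def bs_def cs_def algebra_simps power2_eq_square)
  then show "((\<lambda>u. \<alpha> u + vec u (- r u * r1 u) (- r u * q u * cos t) (r u * q u * sin t))
      has_vector_derivative Cs s t) (at s)"
    using has_vector_derivative_add[OF \<alpha>_deriv[OF s] vec_deriv[OF s d]] by simp
qed

lemma partial_t_C:
  assumes s: "s \<in> I" shows "partial_t C s t = Ct s t"
  unfolding partial_t_def
proof (rule vector_derivative_eq_on_open[OF open_UNIV UNIV_I C_vec[OF s]])
  have "((\<lambda>v. vec s (- r s * r1 s) (- r s * q s * cos v) (r s * q s * sin v))
     has_vector_derivative Ct s t) (at t)"
    unfolding Ct_def by (rule vec_deriv_t) (auto intro!: derivative_eq_intros)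
  from has_vector_derivative_add[OF has_vector_derivative_const this]
  show "((\<lambda>v. \<alpha> s + vec s (- r s * r1 s) (- r s * q s * cos v) (r s * q s * sin v))
     has_vector_derivative Ct s t) (at t)" by simp
qed

text \<open>The normal direction is the direction from the center of the sphere to the point of contact. The sign
of \<open>QP\<close> decides which of the two unit normals the cross product picks.\<close>

lemma cross_Cs_Ct:
  assumes s: "s \<in> I" shows "cross3 (Cs s t) (Ct s t) = (r s * QP s t) *\<^sub>R nn s t"
proof -
  have sc: "a *\<^sub>R vec s x y z = vec s (a * x) (a * y) (a * z)" for a x y z
    by (simp add: vec_def algebra_simps)
  have c: "bs s t * (r s * q s * cos t) - cs s t * (r s * q s * sin t) = r s * QP s t * - r1 s"
    unfolding bs_def cs_def QP_def P_def
    using sin_cos_squared_add[of t] q_squared[OF s] q_q1[OF s] by algebra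
  show ?thesis unfolding Cs_def Ct_def nn_def vec_cross[OF s] sc
    by (rule vec_cong, rule c) (simp_all add: algebra_simps)
qed

lemma nn_unit: "s \<in> I \<Longrightarrow> norm (nn s t) = 1"
proof -
  assume s: "s \<in> I"
  have "nn s t \<bullet> nn s t = 1"
    unfolding nn_def vec_inner[OF s] using sin_cos_squared_add[of t] q_squared[OF s] by algebra
  then show ?thesis by (simp add: norm_eq_1)
qed

lemma first_form:
  assumes s: "s \<in> I"
  shows "ff_E C s t * ff_G C s t - (ff_F C s t)\<^sup>2 = (r s * QP s t)\<^sup>2"
proof -
  have "(norm (cross3 (Cs s t) (Ct s t)))\<^sup>2 = (r s * QP s t)\<^sup>2"
    unfolding cross_Cs_Ct[OF s] by (simp add: nn_unit[OF s])
  then show ?thesis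
    unfolding norm_cross ff_E_def ff_F_def ff_G_def partial_s_C[OF s] partial_t_C[OF s]
    by (simp add: power2_norm_eq_inner)
qed

lemma unit_normal_eq:
  assumes s: "s \<in> I" shows "unit_normal C s t = sgn (QP s t) *\<^sub>R nn s t"
proof -
  have "sgn (nn s t) = nn s t" by (simp add: sgn_div_norm nn_unit[OF s])
  then show ?thesis
    unfolding unit_normal_def partial_s_C[OF s] partial_t_C[OF s] cross_Cs_Ct[OF s] sgn_scaleR
    using r_pos[OF s] by (simp add: sgn_mult)
qed

lemma Cs_nn: "s \<in> I \<Longrightarrow> Cs s t \<bullet> nn s t = 0"
  unfolding Cs_def nn_def vec_inner bs_def cs_def QP_def P_def
  using sin_cos_squared_add[of t] q_squared[of s] q_q1[of s] by algebra

lemma nn_deriv_s: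
  assumes s: "s \<in> I"
  shows "((\<lambda>u. nn u t) has_vector_derivative vec s (P s t)
    (- \<kappa> s * r1 s - q1 s * cos t - \<tau> s * q s * sin t) (q1 s * sin t - \<tau> s * q s * cos t)) (at s)"
proof -
  have d: "((\<lambda>u. - r1 u) has_real_derivative - r2 s) (at s)"
    "((\<lambda>u. - q u * cos t) has_real_derivative - q1 s * cos t) (at s)"
    "((\<lambda>u. q u * sin t) has_real_derivative q1 s * sin t) (at s)"
    by (auto intro!: derivative_eq_intros scalar_derivs s)
  show ?thesis unfolding nn_def
    by (rule has_vector_derivative_eq_rhs[OF vec_deriv[OF s d]])
      (rule vec_cong; simp add: P_def algebra_simps)
qed

lemma nn_deriv_t:
  "((\<lambda>v. nn s v) has_vector_derivative vec s 0 (q s * sin t) (q s * cos t)) (at t)"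
  unfolding nn_def by (rule vec_deriv_t) (auto intro!: derivative_eq_intros)

lemma Cs_deriv_s:
  assumes s: "s \<in> I" obtains d where "((\<lambda>u. Cs u t) has_vector_derivative d) (at s)"
proof -
  note [derivative_intros] = scalar_derivs[OF s, THEN real_differentiableI]
  have "(\<lambda>u. QP u t) differentiable (at s)" "(\<lambda>u. bs u t) differentiable (at s)"
    "(\<lambda>u. cs u t) differentiable (at s)"
    unfolding QP_def bs_def cs_def P_def by (intro derivative_intros)+
  then obtain a b c where "((\<lambda>u. QP u t) has_real_derivative a) (at s)"
    "((\<lambda>u. bs u t) has_real_derivative b) (at s)" "((\<lambda>u. cs u t) has_real_derivative c) (at s)"
    unfolding real_differentiable_def by blast
  from vec_deriv[OF s this] show thesis using that unfolding Cs_def by blast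
qed

lemma Cs_deriv_t:
  obtains d where "((\<lambda>v. Cs s v) has_vector_derivative d) (at t)"
proof -
  have "((\<lambda>v. QP s v) has_real_derivative - r s * q s * \<kappa> s * sin t) (at t)"
    "((\<lambda>v. bs s v) has_real_derivative (r1 s * q s + r s * q1 s) * sin t - \<tau> s * r s * q s * cos t) (at t)"
    "((\<lambda>v. cs s v) has_real_derivative (r1 s * q s + r s * q1 s) * cos t + \<tau> s * r s * q s * sin t) (at t)"
    unfolding QP_def bs_def cs_def P_def by (auto intro!: derivative_eq_intros simp: algebra_simps)
  from vec_deriv_t[OF this] show thesis using that unfolding Cs_def by blast
qed

text \<open>The second derivatives of \<open>C\<close> are never computed: differentiating \<open>C\<^sub>s \<bullet> n = 0\<close> moves one derivative
from \<open>C\<^sub>s\<close> to \<open>n\<close>.\<close>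

lemma sf_e_inner:
  assumes s: "s \<in> I"
  shows "sf_e C s t = - sgn (QP s t) * (Cs s t \<bullet> vec s (P s t)
    (- \<kappa> s * r1 s - q1 s * cos t - \<tau> s * q s * sin t) (q1 s * sin t - \<tau> s * q s * cos t))" (is "_ = - _ * (_ \<bullet> ?n)")
proof -
  obtain d where d: "((\<lambda>u. Cs u t) has_vector_derivative d) (at s)" using Cs_deriv_s[OF s] .
  have "partial_s (partial_s C) s t = d"
    unfolding partial_s_def[of "partial_s C"]
    by (rule vector_derivative_eq_on_open[OF open_I s partial_s_C d])
  moreover have "((\<lambda>u. Cs u t \<bullet> nn u t) has_vector_derivative Cs s t \<bullet> ?n + d \<bullet> nn s t) (at s)"
    by (rule bounded_bilinear.has_vector_derivative[OF bounded_bilinear_inner d nn_deriv_s[OF s]])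
  then have "((\<lambda>u. 0) has_vector_derivative Cs s t \<bullet> ?n + d \<bullet> nn s t) (at s)"
    by (rule has_vector_derivative_transform_within_open[OF _ open_I s]) (simp add: Cs_nn)
  then have "Cs s t \<bullet> ?n + d \<bullet> nn s t = 0"
    using vector_derivative_at has_vector_derivative_const by metis
  then have "d \<bullet> nn s t = - (Cs s t \<bullet> ?n)" by linarith
  ultimately show ?thesis unfolding sf_e_def unit_normal_eq[OF s] inner_scaleR_right by simp
qed

lemma sf_f_inner:
  assumes s: "s \<in> I"
  shows "sf_f C s t = - sgn (QP s t) * (Cs s t \<bullet> vec s 0 (q s * sin t) (q s * cos t))" (is "_ = - _ * (_ \<bullet> ?n)")
proof -
  obtain d where d: "((\<lambda>v. Cs s v) has_vector_derivative d) (at t)" using Cs_deriv_t .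
  have "partial_t (partial_s C) s t = d"
    unfolding partial_t_def
    by (rule vector_derivative_eq_on_open[OF open_UNIV UNIV_I partial_s_C[OF s] d])
  moreover have "((\<lambda>v. Cs s v \<bullet> nn s v) has_vector_derivative Cs s t \<bullet> ?n + d \<bullet> nn s t) (at t)"
    by (rule bounded_bilinear.has_vector_derivative[OF bounded_bilinear_inner d nn_deriv_t])
  then have "Cs s t \<bullet> ?n + d \<bullet> nn s t = 0"
    unfolding Cs_nn[OF s] using vector_derivative_at has_vector_derivative_const by metis
  then have "d \<bullet> nn s t = - (Cs s t \<bullet> ?n)" by linarith
  ultimately show ?thesis unfolding sf_f_def unit_normal_eq[OF s] inner_scaleR_right by simp
qed

lemma sf_g_inner:
  assumes s: "s \<in> I"
  shows "sf_g C s t = - sgn (QP s t) * (r s * (1 - (r1 s)\<^sup>2))"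
proof -
  have "((\<lambda>v. Ct s v) has_vector_derivative vec s 0 (r s * q s * cos t) (- r s * q s * sin t)) (at t)"
    unfolding Ct_def by (rule vec_deriv_t) (auto intro!: derivative_eq_intros)
  then have "partial_t (partial_t C) s t = vec s 0 (r s * q s * cos t) (- r s * q s * sin t)"
    unfolding partial_t_def[of "partial_t C"]
    by (rule vector_derivative_eq_on_open[OF open_UNIV UNIV_I partial_t_C[OF s]])
  then have "sf_g C s t = sgn (QP s t) * (vec s 0 (r s * q s * cos t) (- r s * q s * sin t) \<bullet> nn s t)"
    by (simp add: sf_g_def unit_normal_eq[OF s])
  also have "vec s 0 (r s * q s * cos t) (- r s * q s * sin t) \<bullet> nn s t = - (r s * (1 - (r1 s)\<^sup>2))"
    unfolding nn_def vec_inner[OF s] using sin_cos_squared_add[of t] q_squared[OF s] by algebra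
  finally show ?thesis by simp
qed

text \<open>Writing the second fundamental form with \<open>z\<close> and \<open>y\<close> removes \<open>q\<close> and \<open>\<kappa>\<close>, which only occur in the product
\<open>q \<kappa>\<close>. For \<open>sf_e\<close>, the frame components of the derivative of the normal are multiplied by \<open>q\<close>, because
\<open>q q' = - r' r''\<close> then clears the square root.\<close>

lemma second_form:
  fixes s t :: real
  assumes s: "s \<in> I"
  defines "p \<equiv> 1 - (r1 s)\<^sup>2"
  defines "z \<equiv> r s * q s * \<kappa> s / p * cos t - r s * r2 s / p"
    and "y \<equiv> r1 s * (r s * q s * \<kappa> s / p * sin t) + r s * \<tau> s"
  shows "QP s t = p * (1 + z)"
    "sf_e C s t = sgn (1 + z) * (- p / r s * (z + z\<^sup>2 + y\<^sup>2))"
    "sf_f C s t = sgn (1 + z) * (p * y)"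
    "sf_g C s t = sgn (1 + z) * (- r s * p)"
proof -
  have r: "r s \<noteq> 0" using r_pos[OF s] by simp
  have qp: "q s * q s = p" using q_squared[OF s] by (simp add: p_def)
  have "q s * q s > 0" using q_nonzero[OF s] by (metis not_real_square_gt_zero)
  then have p: "p > 0" by (simp add: qp)
  have z: "p * z = r s * P s t" and y: "p * y = r s * (r1 s * q s * \<kappa> s * sin t + p * \<tau> s)"
    using p by (simp_all add: z_def y_def P_def field_simps)
  show QP: "QP s t = p * (1 + z)" unfolding QP_def p_def[symmetric] using z by (simp add: algebra_simps)
  have sg: "sgn (QP s t) = sgn (1 + z)" unfolding QP using p by (simp add: sgn_mult)
  show "sf_g C s t = sgn (1 + z) * (- r s * p)"
    unfolding sf_g_inner[OF s] sg p_def[symmetric] by simp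
  have "Cs s t \<bullet> vec s 0 (q s * sin t) (q s * cos t) = - (p * y)"
    unfolding Cs_def vec_inner[OF s] y bs_def cs_def
    using sin_cos_squared_add[of t] qp by algebra
  then show "sf_f C s t = sgn (1 + z) * (p * y)"
    unfolding sf_f_inner[OF s] sg by simp
  define wb where "wb = - \<kappa> s * r1 s - q1 s * cos t - \<tau> s * q s * sin t"
  define wc where "wc = q1 s * sin t - \<tau> s * q s * cos t"
  define \<mu> where "\<mu> = r1 s * q s * \<kappa> s * sin t + p * \<tau> s"
  have sc: "(cos t)\<^sup>2 = 1 - (sin t)\<^sup>2" by (rule cos_squared_eq)
  have "bs s t * wb + cs s t * wc = r s * (wb\<^sup>2 + wc\<^sup>2) + r1 s * (q s * (q1 s + \<kappa> s * r1 s * cos t))"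
    unfolding bs_def cs_def wb_def wc_def using sc by algebra
  also have "q s * (q1 s + \<kappa> s * r1 s * cos t) = r1 s * P s t"
    unfolding P_def using q_q1[OF s] by algebra
  finally have 1: "bs s t * wb + cs s t * wc = r s * (wb\<^sup>2 + wc\<^sup>2) + (r1 s)\<^sup>2 * P s t"
    by (simp add: power2_eq_square)
  have 2: "p * (wb\<^sup>2 + wc\<^sup>2) = (r1 s)\<^sup>2 * (P s t)\<^sup>2 + \<mu>\<^sup>2"
  proof -
    have qb: "q s * wb = - r1 s * (q s * \<kappa> s) + r1 s * r2 s * cos t - p * \<tau> s * sin t"
      unfolding wb_def using q_q1[OF s] qp by algebra
    have qc: "q s * wc = - (r1 s * r2 s) * sin t - p * \<tau> s * cos t"
      unfolding wc_def using q_q1[OF s] qp by algebra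
    have "p * (wb\<^sup>2 + wc\<^sup>2) = (q s * wb)\<^sup>2 + (q s * wc)\<^sup>2"
      unfolding qp[symmetric] by (simp add: power2_eq_square algebra_simps)
    also have "\<dots> = (r1 s)\<^sup>2 * (P s t)\<^sup>2 + \<mu>\<^sup>2"
      unfolding qb qc P_def \<mu>_def using sc by algebra
    finally show ?thesis .
  qed
  have y': "p * y = r s * \<mu>" by (simp add: y \<mu>_def)
  have r1p: "(r1 s)\<^sup>2 = 1 - p" by (simp add: p_def)
  have "p * (r s * (QP s t * P s t + bs s t * wb + cs s t * wc))
      = r s * (p * (QP s t * P s t + (r1 s)\<^sup>2 * P s t) + r s * (p * (wb\<^sup>2 + wc\<^sup>2)))"
    using 1 by algebra
  also have "\<dots> = (p * z) * p + (p * z)^2 + (p * y)^2"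
    unfolding 2 z y' QP_def r1p by (simp add: algebra_simps power2_eq_square)
  finally have "p * (r s * (Cs s t \<bullet> vec s (P s t)
    (- \<kappa> s * r1 s - q1 s * cos t - \<tau> s * q s * sin t) (q1 s * sin t - \<tau> s * q s * cos t)))
    = (p * z) * p + (p * z)^2 + (p * y)^2"
    unfolding Cs_def vec_inner[OF s] wb_def wc_def .
  then have "p * r s * (Cs s t \<bullet> vec s (P s t)
    (- \<kappa> s * r1 s - q1 s * cos t - \<tau> s * q s * sin t) (q1 s * sin t - \<tau> s * q s * cos t))
    = p * r s * (p / r s * (z + z\<^sup>2 + y\<^sup>2))"
    using r by (simp add: power2_eq_square algebra_simps)
  then have "Cs s t \<bullet> vec s (P s t)
    (- \<kappa> s * r1 s - q1 s * cos t - \<tau> s * q s * sin t) (q1 s * sin t - \<tau> s * q s * cos t)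
    = p / r s * (z + z\<^sup>2 + y\<^sup>2)"
    by (rule mult_left_cancel[THEN iffD1, rotated]) (use r p in simp)
  then show "sf_e C s t = sgn (1 + z) * (- p / r s * (z + z\<^sup>2 + y\<^sup>2))"
    unfolding sf_e_inner[OF s] sg by simp
qed

end

section \<open>Normal form of the second fundamental form\<close>

lemma vector_derivative_eqI_real:
  fixes f :: "real \<Rightarrow> real"
  assumes "(f has_real_derivative d) (at s)"
  shows "vector_derivative f (at s) = d"
  using assms by (simp add: has_real_derivative_iff_has_vector_derivative vector_derivative_at)

text \<open>The curvatures are given by closed formulas only near a point, since the sign of the normal and the
absolute value in \<open>K\<^sub>I\<^sub>I\<close> are only locally constant. Hence the eventual equality in this rule.\<close>

lemma partial_s_eqI:
  fixes F :: "real \<Rightarrow> real \<Rightarrow> real"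
  assumes "eventually (\<lambda>u. F u t = \<phi> u) (nhds s)" "(\<phi> has_real_derivative d) (at s)"
  shows "partial_s F s t = d"
  unfolding partial_s_def using assms
  by (intro vector_derivative_eqI_real) (simp add: DERIV_cong_ev)

lemma partial_t_eqI:
  fixes F :: "real \<Rightarrow> real \<Rightarrow> real"
  assumes "eventually (\<lambda>v. F s v = \<phi> v) (nhds t)" "(\<phi> has_real_derivative d) (at t)"
  shows "partial_t F s t = d"
  unfolding partial_t_def using assms
  by (intro vector_derivative_eqI_real) (simp add: DERIV_cong_ev)

lemma eventually_sgn_eq:
  fixes f :: "real \<Rightarrow> real"
  assumes "isCont f x" "f x \<noteq> 0"
  shows "eventually (\<lambda>u. sgn (f u) = sgn (f x)) (nhds x)"
proof -
  have lim: "(f \<longlongrightarrow> f x) (nhds x)" using assms(1) by (simp add: continuous_at tendsto_at_iff_tendsto_nhds)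
  show ?thesis
  proof (cases "f x > 0")
    case True
    show ?thesis using order_tendstoD(1)[OF lim True] by eventually_elim (simp add: True)
  next
    case False
    with assms have "f x < 0" by simp
    from order_tendstoD(2)[OF lim this] this show ?thesis by (auto elim: eventually_mono)
  qed
qed

text \<open>The scalar data of a canal surface from which the curvatures are computed rationally: \<open>r1\<close> is \<open>r'\<close>,
\<open>\<nu> = r q \<kappa> / p\<close> and \<open>\<omega> = r r'' / p\<close> with \<open>p = 1 - r'\<^sup>2\<close>. The differential equation for \<open>r1\<close> is the
definition of \<open>\<omega>\<close> solved for \<open>r''\<close>. A digit at the end of a name marks the order of a derivative.\<close>

locale canal_profile =
  fixes I :: "real set" and r r1 \<tau> \<tau>1 \<nu> \<nu>1 \<nu>2 \<omega> \<omega>1 \<omega>2 :: "real \<Rightarrow> real"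
  assumes open_I: "open I"
    and r_pos: "s \<in> I \<Longrightarrow> r s > 0"
    and r1_less: "s \<in> I \<Longrightarrow> (r1 s)\<^sup>2 < 1"
    and \<nu>_nonzero: "s \<in> I \<Longrightarrow> \<nu> s \<noteq> 0"
    and r_deriv: "s \<in> I \<Longrightarrow> (r has_real_derivative r1 s) (at s)"
    and r1_deriv: "s \<in> I \<Longrightarrow> (r1 has_real_derivative (1 - (r1 s)\<^sup>2) * \<omega> s / r s) (at s)"
    and \<tau>_deriv: "s \<in> I \<Longrightarrow> (\<tau> has_real_derivative \<tau>1 s) (at s)"
    and \<nu>_deriv: "s \<in> I \<Longrightarrow> (\<nu> has_real_derivative \<nu>1 s) (at s)"
    and \<nu>1_deriv: "s \<in> I \<Longrightarrow> (\<nu>1 has_real_derivative \<nu>2 s) (at s)"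
    and \<omega>_deriv: "s \<in> I \<Longrightarrow> (\<omega> has_real_derivative \<omega>1 s) (at s)"
    and \<omega>1_deriv: "s \<in> I \<Longrightarrow> (\<omega>1 has_real_derivative \<omega>2 s) (at s)"
begin

definition p where "p s = 1 - (r1 s)\<^sup>2"
definition r2 where "r2 s = p s * \<omega> s / r s"
definition p1 where "p1 s = - 2 * r1 s * r2 s"
definition r3 where "r3 s = (p1 s * \<omega> s + p s * \<omega>1 s - r1 s * r2 s) / r s"
definition p2 where "p2 s = - 2 * (r2 s * r2 s + r1 s * r3 s)"

definition z where "z s t = \<nu> s * cos t - \<omega> s"
definition zs where "zs s t = \<nu>1 s * cos t - \<omega>1 s"
definition S where "S s t = \<nu> s * sin t"
definition y where "y s t = r1 s * S s t + r s * \<tau> s"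
definition ys where "ys s t = r2 s * S s t + r1 s * (\<nu>1 s * sin t) + (r1 s * \<tau> s + r s * \<tau>1 s)"

definition e where "e s t = - p s / r s * (z s t + (z s t)\<^sup>2 + (y s t)\<^sup>2)"
definition f where "f s t = p s * y s t"
definition g where "g s t = - r s * p s"

lemma p_pos: "s \<in> I \<Longrightarrow> p s > 0" using r1_less by (simp add: p_def)
lemma r_nonzero: "s \<in> I \<Longrightarrow> r s \<noteq> 0" using r_pos by force
lemma p_nonzero: "s \<in> I \<Longrightarrow> p s \<noteq> 0" using p_pos by force

lemma r1_deriv': "s \<in> I \<Longrightarrow> (r1 has_real_derivative r2 s) (at s)"
  using r1_deriv by (simp add: r2_def p_def)

lemma p_deriv: "s \<in> I \<Longrightarrow> (p has_real_derivative p1 s) (at s)"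
  unfolding p_def p1_def by (auto intro!: derivative_eq_intros r1_deriv')

lemma r2_deriv: "s \<in> I \<Longrightarrow> (r2 has_real_derivative r3 s) (at s)"
  unfolding r2_def r3_def
  by (auto intro!: derivative_eq_intros p_deriv r_deriv \<omega>_deriv simp: r_nonzero r2_def field_simps power2_eq_square)

lemma p1_deriv: "s \<in> I \<Longrightarrow> (p1 has_real_derivative p2 s) (at s)"
  unfolding p1_def p2_def
  by (auto intro!: derivative_eq_intros r1_deriv' r2_deriv simp: algebra_simps)

lemma z_deriv_s: "s \<in> I \<Longrightarrow> ((\<lambda>u. z u t) has_real_derivative zs s t) (at s)"
  unfolding z_def zs_def by (auto intro!: derivative_eq_intros \<nu>_deriv \<omega>_deriv)

lemma z_deriv_t: "((\<lambda>v. z s v) has_real_derivative - S s t) (at t)"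
  unfolding z_def S_def by (auto intro!: derivative_eq_intros)

lemma S_deriv_s: "s \<in> I \<Longrightarrow> ((\<lambda>u. S u t) has_real_derivative \<nu>1 s * sin t) (at s)"
  unfolding S_def by (auto intro!: derivative_eq_intros \<nu>_deriv)

lemma S_deriv_t: "((\<lambda>v. S s v) has_real_derivative z s t + \<omega> s) (at t)"
  unfolding z_def S_def by (auto intro!: derivative_eq_intros)

lemma y_deriv_s: "s \<in> I \<Longrightarrow> ((\<lambda>u. y u t) has_real_derivative ys s t) (at s)"
  unfolding y_def ys_def
  by (auto intro!: derivative_eq_intros r_deriv r1_deriv' \<tau>_deriv S_deriv_s)

lemma y_deriv_t: "((\<lambda>v. y s v) has_real_derivative r1 s * (z s t + \<omega> s)) (at t)"
  unfolding y_def by (auto intro!: derivative_eq_intros S_deriv_t)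

lemma ys_deriv_t: "((\<lambda>v. ys s v) has_real_derivative
    r2 s * (z s t + \<omega> s) + r1 s * (zs s t + \<omega>1 s)) (at t)"
  unfolding ys_def by (auto intro!: derivative_eq_intros S_deriv_t simp: zs_def)

lemmas basic_derivs = r_deriv r1_deriv' p_deriv p1_deriv z_deriv_s z_deriv_t S_deriv_s S_deriv_t
  y_deriv_s y_deriv_t ys_deriv_t

text \<open>Partial derivatives of the coefficients \<open>e\<close>, \<open>f\<close>, \<open>g\<close> that occur in the formula for \<open>K\<^sub>I\<^sub>I\<close>.\<close>

definition es where "es s t = (- p1 s * (z s t + (z s t)\<^sup>2 + (y s t)\<^sup>2)
   - p s * ((1 + 2 * z s t) * zs s t + 2 * y s t * ys s t) - r1 s * e s t) / r s"
definition et where "et s t = p s / r s * ((1 + 2 * z s t) * S s t - 2 * y s t * r1 s * (z s t + \<omega> s))"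
definition ett where "ett s t = p s / r s * (- 2 * (S s t)\<^sup>2 + (1 + 2 * z s t) * (z s t + \<omega> s)
   - 2 * (r1 s * (z s t + \<omega> s))\<^sup>2 + 2 * y s t * r1 s * S s t)"
definition fs where "fs s t = p1 s * y s t + p s * ys s t"
definition ft where "ft s t = p s * r1 s * (z s t + \<omega> s)"
definition f_st where "f_st s t = p1 s * r1 s * (z s t + \<omega> s)
   + p s * (r2 s * (z s t + \<omega> s) + r1 s * (zs s t + \<omega>1 s))"
definition gs where "gs s t = - r1 s * p s - r s * p1 s" for t :: real
definition gss where "gss s t = - r2 s * p s - 2 * r1 s * p1 s - r s * p2 s" for t :: real

lemma e_deriv_s: "s \<in> I \<Longrightarrow> ((\<lambda>u. e u t) has_real_derivative es s t) (at s)"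
  unfolding e_def es_def
  by (auto intro!: derivative_eq_intros basic_derivs simp: r_nonzero field_simps power2_eq_square)

lemma e_deriv_t: "s \<in> I \<Longrightarrow> ((\<lambda>v. e s v) has_real_derivative et s t) (at t)"
  unfolding e_def et_def
  by (auto intro!: derivative_eq_intros basic_derivs simp: r_nonzero field_simps power2_eq_square)

lemma et_deriv_t: "s \<in> I \<Longrightarrow> ((\<lambda>v. et s v) has_real_derivative ett s t) (at t)"
  unfolding et_def ett_def
  by (auto intro!: derivative_eq_intros basic_derivs simp: r_nonzero field_simps power2_eq_square)

lemma f_deriv_s: "s \<in> I \<Longrightarrow> ((\<lambda>u. f u t) has_real_derivative fs s t) (at s)"
  unfolding f_def fs_def by (auto intro!: derivative_eq_intros basic_derivs)

lemma f_deriv_t: "((\<lambda>v. f s v) has_real_derivative ft s t) (at t)"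
  unfolding f_def ft_def by (auto intro!: derivative_eq_intros basic_derivs)

lemma fs_deriv_t: "((\<lambda>v. fs s v) has_real_derivative f_st s t) (at t)"
  unfolding fs_def f_st_def by (auto intro!: derivative_eq_intros basic_derivs)

lemma g_deriv_s: "s \<in> I \<Longrightarrow> ((\<lambda>u. g u t) has_real_derivative gs s t) (at s)"
  unfolding g_def gs_def by (auto intro!: derivative_eq_intros basic_derivs)

lemma g_deriv_t: "((\<lambda>v. g s v) has_real_derivative 0) (at t)"
  unfolding g_def by (auto intro!: derivative_eq_intros)

lemma gs_deriv_s: "s \<in> I \<Longrightarrow> ((\<lambda>u. gs u t) has_real_derivative gss s t) (at s)"
  unfolding gs_def gss_def by (auto intro!: derivative_eq_intros basic_derivs)

definition H where "H s t = 4 * (z s t)^4 + 6 * (z s t)^3 + 2 * (z s t)\<^sup>2 + (S s t)\<^sup>2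
   + r s * r1 s / p s * (zs s t - \<tau> s * S s t)"

text \<open>The left-hand side is the difference of the two determinants in the formula for \<open>K\<^sub>I\<^sub>I\<close>, with \<open>g\<^sub>t = 0\<close>.
That so little survives has a geometric reason: in the coframe \<open>ds\<close>, \<open>y ds - r dt\<close> the form is diagonal, and
\<open>y\<close> enters the exterior derivative of the coframe only through \<open>y\<^sub>t\<close>, which is free of \<open>\<tau>\<close>. Hence no
derivative of \<open>\<tau>\<close> is left.\<close>

lemma brioschi_numerator:
  assumes "s \<in> I"
  shows "(- (1/2) * ett s t + f_st s t - (1/2) * gss s t) * (e s t * g s t - (f s t)\<^sup>2)
     - (1/2) * es s t * (ft s t - (1/2) * gs s t) * g s t
     + (fs s t - (1/2) * et s t) * (ft s t - (1/2) * gs s t) * f s t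
     + (1/4) * (et s t)\<^sup>2 * g s t - (1/2) * et s t * gs s t * f s t + (1/4) * e s t * (gs s t)\<^sup>2
     = - ((p s)^4 / (4 * r s) * H s t)" (is "?N = _")
proof -
  note nz = r_nonzero[OF assms] p_nonzero[OF assms]
  define q where "q = 1 / r s"
  have q: "q * r s = 1" using nz by (simp add: q_def)
  have P: "r1 s * r1 s = 1 - p s" by (simp add: p_def power2_eq_square)
  have e': "e s t = - q * p s * (z s t + (z s t)\<^sup>2 + (y s t)\<^sup>2)"
    by (simp add: q_def e_def)
  have r2': "r2 s = q * p s * \<omega> s" by (simp add: q_def r2_def)
  have r3': "r3 s = q * (p1 s * \<omega> s + p s * \<omega>1 s - r1 s * r2 s)" by (simp add: q_def r3_def)
  have et': "et s t = q * p s * ((1 + 2 * z s t) * S s t - 2 * y s t * r1 s * (z s t + \<omega> s))"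
    by (simp add: q_def et_def)
  have ett': "ett s t = q * p s * (- 2 * (S s t)\<^sup>2 + (1 + 2 * z s t) * (z s t + \<omega> s)
      - 2 * (r1 s * (z s t + \<omega> s))\<^sup>2 + 2 * y s t * r1 s * S s t)"
    by (simp add: q_def ett_def)
  have es': "es s t = q * (- p1 s * (z s t + (z s t)\<^sup>2 + (y s t)\<^sup>2)
      - p s * ((1 + 2 * z s t) * zs s t + 2 * y s t * ys s t) - r1 s * e s t)"
    by (simp add: q_def es_def)
  have \<tau>: "r s * \<tau> s = y s t - r1 s * S s t" by (simp add: y_def)
  have "4 * r s * r s * ?N = - (p s ^ 3) * r s * (p s * (4 * (z s t)^4 + 6 * (z s t)^3
      + 2 * (z s t)\<^sup>2 + (S s t)\<^sup>2) + r s * r1 s * zs s t - r1 s * (y s t - r1 s * S s t) * S s t)"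
    unfolding es' et' ett' e' f_def g_def ft_def f_st_def gs_def gss_def fs_def p2_def r3' p1_def r2'
    using q P by algebra
  also have "\<dots> = 4 * r s * r s * (- ((p s)^4 / (4 * r s) * H s t))"
    using nz unfolding \<tau>[symmetric] H_def by (simp add: field_simps eval_nat_numeral)
  finally have "4 * r s * r s * ?N = 4 * r s * r s * (- ((p s)^4 / (4 * r s) * H s t))" .
  moreover have "4 * r s * r s \<noteq> 0" using nz by simp
  ultimately show ?thesis using mult_left_cancel by blast
qed

end

section \<open>The two curvatures and their derivatives\<close>

context canal_profile
begin

definition w where "w s t = z s t + (z s t)\<^sup>2"

text \<open>Using \<open>S\<^sup>2 = \<nu>\<^sup>2 - (z + \<omega>)\<^sup>2\<close> and \<open>z\<^sub>s = (\<nu>' / \<nu>) (z + \<omega>) - \<omega>'\<close>, both \<open>H\<close> and \<open>J\<close> become polynomials in \<open>z\<close>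
plus a multiple of \<open>S\<close>. The following functions of \<open>s\<close> are the coefficients, with
the power of \<open>z\<close> as digit; their derivatives carry a prime. The parameter \<open>l\<close> is \<open>0\<close> where
\<open>e g > 0\<close> and \<open>1\<close> where \<open>e g < 0\<close>, so that \<open>(\<bar>e g\<bar> - f\<^sup>2)\<^sup>2 = (p\<^sup>2 J)\<^sup>2\<close> in both cases.\<close>

definition \<beta> where "\<beta> s = r s * r1 s / p s"
definition h1 where "h1 s = \<beta> s * (\<nu>1 s / \<nu> s) - 2 * \<omega> s"
definition h0 where "h0 s = (\<nu> s)\<^sup>2 - (\<omega> s)\<^sup>2 + \<beta> s * (\<nu>1 s / \<nu> s * \<omega> s - \<omega>1 s)"
definition h where "h s = \<beta> s * \<tau> s"
definition j2 :: "real \<Rightarrow> real \<Rightarrow> real" where "j2 l s = 1 - 2 * l * (r1 s)\<^sup>2"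
definition j1 :: "real \<Rightarrow> real \<Rightarrow> real" where "j1 l s = 1 - 4 * l * (r1 s)\<^sup>2 * \<omega> s"
definition j0 :: "real \<Rightarrow> real \<Rightarrow> real" where
  "j0 l s = 2 * l * ((r1 s)\<^sup>2 * ((\<nu> s)\<^sup>2 - (\<omega> s)\<^sup>2) + (r s * \<tau> s)\<^sup>2)"
definition j :: "real \<Rightarrow> real \<Rightarrow> real" where "j l s = 4 * l * r s * r1 s * \<tau> s"
definition J :: "real \<Rightarrow> real \<Rightarrow> real \<Rightarrow> real" where "J l s t = w s t + 2 * l * (y s t)\<^sup>2"

lemma S_squared: "(S s t)\<^sup>2 = (\<nu> s)\<^sup>2 - (z s t + \<omega> s)\<^sup>2"
  by (simp add: S_def z_def power_mult_distrib sin_squared_eq algebra_simps)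

lemma zs_eq: "s \<in> I \<Longrightarrow> zs s t = \<nu>1 s / \<nu> s * (z s t + \<omega> s) - \<omega>1 s"
  using \<nu>_nonzero by (simp add: zs_def z_def)

lemma H_eq: "s \<in> I \<Longrightarrow> H s t = 4 * (z s t)^4 + 6 * (z s t)^3 + (z s t)\<^sup>2
    + h1 s * z s t + h0 s - h s * S s t"
  unfolding H_def S_squared zs_eq \<beta>_def[symmetric] h1_def h0_def h_def
  by (simp add: power2_eq_square algebra_simps)

lemma J_eq: "J l s t = j2 l s * (z s t)\<^sup>2 + j1 l s * z s t + j0 l s + j l s * S s t"
proof -
  have "J l s t = w s t + 2 * l * ((r1 s)\<^sup>2 * (S s t)\<^sup>2 + (r s * \<tau> s)\<^sup>2 + 2 * r1 s * r s * \<tau> s * S s t)"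
    by (simp add: J_def y_def power2_eq_square algebra_simps)
  then show ?thesis unfolding S_squared w_def j2_def j1_def j0_def j_def
    by (simp add: power2_eq_square algebra_simps)
qed

text \<open>The derivatives of the coefficients of \<open>J\<close> are written out, because they enter the leading coefficients
of the Jacobi function below.\<close>

definition h1' where "h1' s = deriv h1 s"
definition h0' where "h0' s = deriv h0 s"
definition h' where "h' s = deriv h s"
definition j2' :: "real \<Rightarrow> real \<Rightarrow> real" where "j2' l s = - 4 * l * r1 s * r2 s"
definition j1' :: "real \<Rightarrow> real \<Rightarrow> real" where
  "j1' l s = - 4 * l * (2 * r1 s * r2 s * \<omega> s + (r1 s)\<^sup>2 * \<omega>1 s)"
definition j0' :: "real \<Rightarrow> real \<Rightarrow> real" where
  "j0' l s = 2 * l * (2 * r1 s * r2 s * ((\<nu> s)\<^sup>2 - (\<omega> s)\<^sup>2)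
     + (r1 s)\<^sup>2 * (2 * \<nu> s * \<nu>1 s - 2 * \<omega> s * \<omega>1 s)
     + 2 * r s * \<tau> s * (r1 s * \<tau> s + r s * \<tau>1 s))"
definition j' :: "real \<Rightarrow> real \<Rightarrow> real" where
  "j' l s = 4 * l * (r1 s * r1 s * \<tau> s + r s * r2 s * \<tau> s + r s * r1 s * \<tau>1 s)"

lemma \<beta>_differentiable: "s \<in> I \<Longrightarrow> \<beta> differentiable (at s)"
  unfolding \<beta>_def using r_deriv r1_deriv' p_deriv p_nonzero
  by (intro derivative_intros) (auto simp: real_differentiable_def)

lemma h_deriv: 
  assumes "s \<in> I"
  shows "(h has_real_derivative h' s) (at s)" "(h1 has_real_derivative h1' s) (at s)"
    "(h0 has_real_derivative h0' s) (at s)"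
proof -
  have d: "\<nu> differentiable (at s)" "\<nu>1 differentiable (at s)" "\<omega> differentiable (at s)"
    "\<omega>1 differentiable (at s)" "\<tau> differentiable (at s)" "\<beta> differentiable (at s)"
    using \<beta>_differentiable[OF assms] \<nu>_deriv[OF assms] \<nu>1_deriv[OF assms] \<omega>_deriv[OF assms]
      \<omega>1_deriv[OF assms] \<tau>_deriv[OF assms]
    unfolding real_differentiable_def by blast+
  note [derivative_intros] = d
  show "(h has_real_derivative h' s) (at s)" "(h1 has_real_derivative h1' s) (at s)"
    "(h0 has_real_derivative h0' s) (at s)"
    using \<nu>_nonzero[OF assms]
    unfolding h'_def h1'_def h0'_def h_def h1_def h0_def DERIV_deriv_iff_real_differentiable
    by (auto intro!: derivative_intros)
qed

lemma j_deriv: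
  assumes "s \<in> I"
  shows "(j l has_real_derivative j' l s) (at s)" "(j2 l has_real_derivative j2' l s) (at s)"
    "(j1 l has_real_derivative j1' l s) (at s)" "(j0 l has_real_derivative j0' l s) (at s)"
  using assms unfolding j_def j2_def j1_def j0_def j'_def j2'_def j1'_def j0'_def
  by (auto intro!: derivative_eq_intros basic_derivs \<nu>_deriv \<omega>_deriv \<tau>_deriv
      simp: algebra_simps power2_eq_square)

definition Hs where "Hs s t = (16 * (z s t)^3 + 18 * (z s t)\<^sup>2 + 2 * z s t + h1 s) * zs s t
    + h1' s * z s t + h0' s - h' s * S s t - h s * (\<nu>1 s * sin t)"
definition Ht where "Ht s t = - (16 * (z s t)^3 + 18 * (z s t)\<^sup>2 + 2 * z s t + h1 s) * S s t
    - h s * (z s t + \<omega> s)"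
definition Js where "Js l s t = (2 * j2 l s * z s t + j1 l s) * zs s t
    + j2' l s * (z s t)\<^sup>2 + j1' l s * z s t + j0' l s + j' l s * S s t + j l s * (\<nu>1 s * sin t)"
definition Jt where "Jt l s t = - (2 * j2 l s * z s t + j1 l s) * S s t + j l s * (z s t + \<omega> s)"

lemma H_deriv_s:
  assumes "s \<in> I" 
  shows "((\<lambda>u. H u t) has_real_derivative Hs s t) (at s)"
proof -
  have "((\<lambda>u. 4 * (z u t)^4 + 6 * (z u t)^3 + (z u t)\<^sup>2 + h1 u * z u t + h0 u - h u * S u t)
     has_real_derivative Hs s t) (at s)"
    using assms h_deriv[OF assms] unfolding Hs_def
    by (auto intro!: derivative_eq_intros basic_derivs simp: algebra_simps power2_eq_square)
  then show ?thesis
    by (rule has_field_derivative_transform_within_open[OF _ open_I assms]) (simp add: H_eq)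
qed

lemma H_deriv_t: "s \<in> I \<Longrightarrow> ((\<lambda>v. H s v) has_real_derivative Ht s t) (at t)"
  unfolding H_eq Ht_def
  by (auto intro!: derivative_eq_intros basic_derivs simp: algebra_simps power2_eq_square)

lemma J_deriv_s:
  assumes "s \<in> I" 
  shows "((\<lambda>u. J l u t) has_real_derivative Js l s t) (at s)"
  using assms j_deriv[OF assms] unfolding Js_def J_eq
  by (auto intro!: derivative_eq_intros basic_derivs simp: algebra_simps power2_eq_square)

lemma J_deriv_t: "((\<lambda>v. J l s v) has_real_derivative Jt l s t) (at t)"
  unfolding J_eq Jt_def
  by (auto intro!: derivative_eq_intros basic_derivs simp: algebra_simps power2_eq_square)

definition Gauss where "Gauss s t = z s t / ((r s)\<^sup>2 * (1 + z s t))"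
definition SecondGauss where "SecondGauss l s t = - H s t / (4 * r s * (J l s t)\<^sup>2)"

lemma Gauss_deriv_s: "s \<in> I \<Longrightarrow> 1 + z s t \<noteq> 0 \<Longrightarrow>
  ((\<lambda>u. Gauss u t) has_real_derivative
     (zs s t - 2 * (r1 s / r s) * w s t) / ((r s)\<^sup>2 * (1 + z s t)\<^sup>2)) (at s)"
  unfolding Gauss_def w_def
  by (auto intro!: derivative_eq_intros basic_derivs simp: r_nonzero)
    (simp add: r_nonzero divide_simps, simp add: algebra_simps power2_eq_square)

lemma Gauss_deriv_t: "s \<in> I \<Longrightarrow> 1 + z s t \<noteq> 0 \<Longrightarrow>
  ((\<lambda>v. Gauss s v) has_real_derivative - S s t / ((r s)\<^sup>2 * (1 + z s t)\<^sup>2)) (at t)"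
  unfolding Gauss_def
  by (auto intro!: derivative_eq_intros basic_derivs simp: r_nonzero)
    (simp add: r_nonzero divide_simps, simp add: algebra_simps power2_eq_square)

lemma SecondGauss_deriv_s: "s \<in> I \<Longrightarrow> J l s t \<noteq> 0 \<Longrightarrow>
  ((\<lambda>u. SecondGauss l u t) has_real_derivative
     (r1 s / r s * H s t * J l s t - Hs s t * J l s t + 2 * H s t * Js l s t) / (4 * r s * (J l s t)^3)) (at s)"
  unfolding SecondGauss_def
  by (auto intro!: derivative_eq_intros basic_derivs H_deriv_s J_deriv_s simp: r_nonzero)
    (simp add: r_nonzero divide_simps, simp add: algebra_simps eval_nat_numeral)

lemma SecondGauss_deriv_t: "s \<in> I \<Longrightarrow> J l s t \<noteq> 0 \<Longrightarrow>
  ((\<lambda>v. SecondGauss l s v) has_real_derivative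
     (2 * H s t * Jt l s t - Ht s t * J l s t) / (4 * r s * (J l s t)^3)) (at t)"
  unfolding SecondGauss_def
  by (auto intro!: derivative_eq_intros basic_derivs H_deriv_t J_deriv_t simp: r_nonzero)
    (simp add: r_nonzero divide_simps, simp add: algebra_simps eval_nat_numeral)

end

section \<open>The Jacobi function as a trigonometric polynomial\<close>

context canal_profile
begin

text \<open>If \<open>\<delta>\<close> denotes differentiation in \<open>s\<close> along a curve on which \<open>K\<close> is constant, then the Jacobi function
vanishes exactly if \<open>\<delta>\<close> annihilates \<open>H / (r J\<^sup>2)\<close>. On such a curve \<open>\<delta> z = 2 (r' / r) (z + z\<^sup>2)\<close> and
\<open>S \<delta> S = \<nu> \<nu>' - (z + \<omega>) (\<delta> z + \<omega>')\<close>. The polynomials \<open>H_flow\<close> and \<open>J_flow\<close> are \<open>\<delta>\<close> applied to the parts of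
\<open>H\<close> and \<open>J\<close> without \<open>S\<close>, and \<open>sine_flow\<close> is \<open>S \<delta> S\<close>.\<close>

definition w_poly :: "real poly" where "w_poly = [:0, 1, 1:]"
definition H_poly where "H_poly s = [:h0 s, h1 s, 1, 6, 4:]"
definition J_poly where "J_poly l s = [:j0 l s, j1 l s, j2 l s:]"
definition S_squared_poly where "S_squared_poly s = [:(\<nu> s)\<^sup>2 - (\<omega> s)\<^sup>2, - 2 * \<omega> s, -1:]"
definition H_flow where "H_flow s = [:h0' s, h1' s:] + smult (2 * (r1 s / r s)) (w_poly * [:h1 s, 2, 18, 16:])"
definition J_flow where "J_flow l s = [:j0' l s, j1' l s, j2' l s:]
    + smult (2 * (r1 s / r s)) (w_poly * [:j1 l s, 2 * j2 l s:])"
definition sine_flow where "sine_flow s = [:\<nu> s * \<nu>1 s:] - [:\<omega> s, 1:] * (smult (2 * (r1 s / r s)) w_poly + [:\<omega>1 s:])"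

text \<open>After multiplication by \<open>S\<close>, the condition \<open>- (r' / r) H J + J \<delta> H - 2 H \<delta> J = 0\<close> is polynomial in \<open>z\<close> and \<open>S\<close>.
It is sorted by the parity in \<open>S\<close>; the names refer to the parity before that multiplication.\<close>

definition even_part where "even_part l s =
    smult (- (r1 s / r s)) (H_poly s * J_poly l s - smult (h s * j l s) (S_squared_poly s))
    + J_poly l s * H_flow s - smult 2 (H_poly s * J_flow l s)
    - smult (j l s) (smult (h' s) (S_squared_poly s) + smult (h s) (sine_flow s))
    + smult (2 * h s) (smult (j' l s) (S_squared_poly s) + smult (j l s) (sine_flow s))"

definition odd_part where "odd_part l s =
    smult (- (r1 s / r s)) ((smult (j l s) (H_poly s) - smult (h s) (J_poly l s)) * S_squared_poly s)
    - J_poly l s * (smult (h' s) (S_squared_poly s) + smult (h s) (sine_flow s))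
    + smult (j l s) (S_squared_poly s * H_flow s)
    - smult 2 (H_poly s * (smult (j' l s) (S_squared_poly s) + smult (j l s) (sine_flow s)))
    + smult (2 * h s) (S_squared_poly s * J_flow l s)"

lemma jacobi_polynomial:
  assumes s: "s \<in> I" and nz: "1 + z s t \<noteq> 0" "J l s t \<noteq> 0"
    and jac: "(zs s t - 2 * (r1 s / r s) * w s t) / ((r s)\<^sup>2 * (1 + z s t)\<^sup>2)
        * ((2 * H s t * Jt l s t - Ht s t * J l s t) / (4 * r s * (J l s t)^3))
      - (- S s t / ((r s)\<^sup>2 * (1 + z s t)\<^sup>2))
        * ((r1 s / r s * H s t * J l s t - Hs s t * J l s t + 2 * H s t * Js l s t)
            / (4 * r s * (J l s t)^3)) = 0"
  shows "poly (odd_part l s) (z s t) + S s t * poly (even_part l s) (z s t) = 0"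
proof -
  define \<rho> where "\<rho> = r1 s / r s"
  define k where "k = zs s t - 2 * \<rho> * w s t"
  define D where "D = ((r s)\<^sup>2 * (1 + z s t)\<^sup>2) * (4 * r s * (J l s t)^3)"
  have D: "D \<noteq> 0" using nz r_nonzero[OF s] by (simp add: D_def)
  have aux: "x / a * (u / b) - (- v / a) * (x' / b) = (x * u + v * x') / (a * b)"
    for x u v x' a b :: real by (simp add: add_divide_distrib)
  have "(k * (2 * H s t * Jt l s t - Ht s t * J l s t)
      + S s t * (\<rho> * H s t * J l s t - Hs s t * J l s t + 2 * H s t * Js l s t)) / D = 0"
    using jac unfolding \<rho>_def[symmetric] k_def[symmetric] D_def by (simp only: aux)
  then have *: "J l s t * (S s t * Hs s t + k * Ht s t) - \<rho> * S s t * H s t * J l s t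
      - 2 * H s t * (S s t * Js l s t + k * Jt l s t) = 0"
    using D by (simp add: algebra_simps)
  define Sv zv where "Sv = S s t" and "zv = z s t"
  have S_squared_poly: "Sv * Sv = poly (S_squared_poly s) zv"
    using S_squared[of s t] by (simp add: S_squared_poly_def Sv_def zv_def power2_eq_square algebra_simps)
  have sine_flow: "Sv * (\<nu>1 s * sin t) + k * (zv + \<omega> s) = poly (sine_flow s) zv"
  proof -
    have "Sv * (\<nu>1 s * sin t) + zs s t * (zv + \<omega> s) = \<nu> s * \<nu>1 s - \<omega>1 s * (zv + \<omega> s)"
      unfolding Sv_def S_def zs_def zv_def z_def using sin_cos_squared_add[of t] by algebra
    then show ?thesis
      by (simp add: sine_flow_def w_poly_def k_def \<rho>_def[symmetric] w_def zv_def[symmetric] algebra_simps power2_eq_square)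
  qed
  have HS: "Sv * Hs s t + k * Ht s t = Sv * poly (H_flow s) zv - h' s * (Sv * Sv)
       - h s * (Sv * (\<nu>1 s * sin t) + k * (zv + \<omega> s))"
    by (simp add: Hs_def Ht_def H_flow_def w_poly_def k_def \<rho>_def[symmetric] w_def zv_def[symmetric] Sv_def[symmetric]
        algebra_simps eval_nat_numeral)
  have JS: "Sv * Js l s t + k * Jt l s t = Sv * poly (J_flow l s) zv + j' l s * (Sv * Sv)
       + j l s * (Sv * (\<nu>1 s * sin t) + k * (zv + \<omega> s))"
    by (simp add: Js_def Jt_def J_flow_def w_poly_def k_def \<rho>_def[symmetric] w_def zv_def[symmetric] Sv_def[symmetric]
        algebra_simps eval_nat_numeral)
  have Hv: "H s t = poly (H_poly s) zv - h s * Sv"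
    by (simp add: H_eq[OF s] H_poly_def zv_def Sv_def algebra_simps eval_nat_numeral)
  have Jv: "J l s t = poly (J_poly l s) zv + j l s * Sv"
    by (simp add: J_eq J_poly_def zv_def Sv_def algebra_simps eval_nat_numeral)
  have "poly (odd_part l s) zv + Sv * poly (even_part l s) zv =
     J l s t * (Sv * Hs s t + k * Ht s t) - \<rho> * Sv * H s t * J l s t
      - 2 * H s t * (Sv * Js l s t + k * Jt l s t)"
    unfolding HS JS sine_flow odd_part_def even_part_def poly_add poly_diff poly_mult poly_smult \<rho>_def[symmetric] Hv Jv S_squared_poly[symmetric]
    by (simp add: algebra_simps)
  with * show ?thesis by (simp add: Sv_def zv_def)
qed

text \<open>The coefficient of \<open>z\<^sup>7\<close>: the contribution \<open>- 32 (r' / r) j\<close> of \<open>\<delta> H\<close> and \<open>16 (r' / r) j\<close> of \<open>\<delta> S\<close> do not cancel.\<close>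

lemma odd_part_coeff:
  assumes "odd_part l s = 0"
  shows "(r1 s / r s) * j l s = 0"
proof -
  have "coeff (odd_part l s) 7 = 0" using assms by simp
  moreover have "coeff (odd_part l s) 7 = -16 * (r1 s / r s) * j l s"
    by (simp add: odd_part_def H_poly_def J_poly_def S_squared_poly_def H_flow_def J_flow_def sine_flow_def w_poly_def eval_nat_numeral)
  ultimately show ?thesis by simp
qed

text \<open>Here \<open>J = z + z\<^sup>2\<close> divides the even part, and the quotient is a cubic with leading coefficient \<open>2 r' / r\<close>.\<close>

lemma even_part_coeff_definite:
  assumes "even_part 0 s = 0"
  shows "r1 s / r s = 0"
proof -
  have "coeff (even_part 0 s) 5 = 2 * (r1 s / r s)"
    by (simp add: even_part_def H_poly_def J_poly_def S_squared_poly_def H_flow_def J_flow_def sine_flow_def w_poly_def eval_nat_numeral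
        j2_def j1_def j0_def j_def j2'_def j1'_def j0'_def j'_def)
  with assms show ?thesis by simp
qed

text \<open>The coefficients of \<open>z\<^sup>6\<close>, \<open>z\<^sup>5\<close> and \<open>z\<^sup>4\<close>. The coefficient of \<open>z\<^sup>7\<close> cancels, since \<open>H\<close> and \<open>J\<^sup>2\<close> have
the same degree in \<open>z\<close>.\<close>

lemma even_part_coeff_indefinite:
  assumes "\<tau> s = 0" "even_part 1 s = 0"
  defines "\<rho> \<equiv> r1 s / r s"
  shows "2 * \<rho> * (j1 1 s - j2 1 s) = j2' 1 s" (is ?c6)
    and "2 * \<rho> * (- 11 * j2 1 s + 12 * j1 1 s + 16 * j0 1 s) = 8 * j1' 1 s + 12 * j2' 1 s" (is ?c5)
    and "2 * \<rho> * (j2 1 s * (- 5/2 - 3 * h1 s) + 3 * j1 1 s + 32 * j0 1 s)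
       = 8 * j0' 1 s + 12 * j1' 1 s + 2 * j2' 1 s" (is ?c4)
proof -
  have "j 1 s = 0" "h s = 0" using assms by (simp_all add: j_def h_def)
  then have e: "even_part 1 s = smult (- \<rho>) (H_poly s * J_poly 1 s) + J_poly 1 s * H_flow s - smult 2 (H_poly s * J_flow 1 s)"
    by (simp add: even_part_def \<rho>_def)
  note defs = H_poly_def J_poly_def H_flow_def J_flow_def w_poly_def
  have "coeff (even_part 1 s) 6 = 8 * \<rho> * (j1 1 s - j2 1 s) * 2 - 8 * j2' 1 s"
    unfolding e defs \<rho>_def[symmetric] by (simp add: eval_nat_numeral algebra_simps)
  with assms(2) show ?c6 by simp
  have "coeff (even_part 1 s) 5 = 2 * \<rho> * (- 11 * j2 1 s + 12 * j1 1 s + 16 * j0 1 s)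
       - (8 * j1' 1 s + 12 * j2' 1 s)"
    unfolding e defs \<rho>_def[symmetric] by (simp add: eval_nat_numeral algebra_simps)
  with assms(2) show ?c5 by simp
  have "coeff (even_part 1 s) 4 = 2 * \<rho> * (j2 1 s * (- 5/2 - 3 * h1 s) + 3 * j1 1 s + 32 * j0 1 s)
       - (8 * j0' 1 s + 12 * j1' 1 s + 2 * j2' 1 s)"
    unfolding e defs \<rho>_def[symmetric] by (simp add: eval_nat_numeral algebra_simps)
  with assms(2) show ?c4 by simp
qed

text \<open>For constant radius \<open>\<delta> z = 0\<close> and \<open>\<omega> = 0\<close>. The coefficient of \<open>z\<^sup>4\<close> shows that \<open>j0\<close> is stationary, and then
those of \<open>z\<^sup>3\<close> and \<open>z\<^sup>2\<close> show the same for \<open>h0\<close>, which is \<open>\<nu>\<^sup>2\<close> in this case.\<close>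

lemma even_part_coeff_tube:
  assumes r1: "\<And>s. s \<in> I \<Longrightarrow> r1 s = 0" and s: "s \<in> I" and "even_part l s = 0"
  shows "\<nu>1 s = 0"
proof -
  have \<omega>: "\<omega> u = 0" if "u \<in> I" for u
  proof -
    have "((\<lambda>u. 0) has_real_derivative r2 u) (at u)"
      by (rule has_field_derivative_transform_within_open[OF r1_deriv' open_I]) (use that r1 in auto)
    then have "r2 u = 0" using DERIV_unique[OF _ DERIV_const] by fastforce
    then show ?thesis using that r_nonzero p_nonzero by (simp add: r2_def)
  qed
  have 0: "r1 s = 0" "r2 s = 0" "h s = 0" "j2' l s = 0" "j1' l s = 0" "j l s = 0" "j' l s = 0" "j2 l s = 1"
    using r1[OF s] \<omega>[OF s] by (simp_all add: r2_def h_def \<beta>_def j2'_def j1'_def j_def j'_def j2_def)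
  have e: "even_part l s = J_poly l s * [:h0' s, h1' s:] - smult 2 (H_poly s * [:j0' l s:])"
    unfolding even_part_def H_flow_def J_flow_def using 0 by simp
  have c: "coeff (even_part l s) 4 = - 8 * j0' l s" "coeff (even_part l s) 3 = h1' s - 12 * j0' l s"
    "coeff (even_part l s) 2 = h0' s + j1 l s * h1' s - 2 * j0' l s"
    unfolding e J_poly_def H_poly_def using 0 by (simp_all add: eval_nat_numeral)
  with assms(3) have h0': "h0' s = 0" by simp
  have "((\<lambda>u. (\<nu> u)\<^sup>2) has_real_derivative h0' s) (at s)"
    by (rule has_field_derivative_transform_within_open[OF h_deriv(3)[OF s] open_I s])
      (simp add: h0_def \<beta>_def r1 \<omega>)
  moreover have "((\<lambda>u. (\<nu> u)\<^sup>2) has_real_derivative 2 * \<nu> s * \<nu>1 s) (at s)"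
    by (auto intro!: derivative_eq_intros \<nu>_deriv s)
  ultimately have "2 * \<nu> s * \<nu>1 s = 0" using DERIV_unique h0' by metis
  then show ?thesis using \<nu>_nonzero[OF s] by simp
qed

text \<open>Up to the factor \<open>p\<^sup>2\<close> the expression is \<open>e g\<close>. It is \<open>J\<close> for the parameter \<open>1/2\<close>, whose coefficient
of \<open>z\<^sup>2\<close> is \<open>1 - r'\<^sup>2 > 0\<close>.\<close>

lemma definite_somewhere:
  assumes "s \<in> I" "a < b"
  shows "\<exists>t\<in>{a<..<b}. w s t + (y s t)\<^sup>2 \<noteq> 0"
proof (rule ccontr)
  assume "\<not> ?thesis"
  then have "J (1/2) s t = 0" if "t \<in> {a<..<b}" for t using that by (simp add: J_def)
  then have "poly (J_poly (1/2) s) (\<nu> s * cos t - \<omega> s) + \<nu> s * sin t * poly [:j (1/2) s:] (\<nu> s * cos t - \<omega> s) = 0"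
    if "t \<in> {a<..<b}" for t
    using that unfolding J_eq by (simp add: J_poly_def z_def S_def algebra_simps power2_eq_square)
  from affine_trig_poly_eq_0(1)[OF assms(2) \<nu>_nonzero[OF assms(1)] this]
  have "j2 (1/2) s = 0" by (simp add: J_poly_def)
  then show False using r1_less[OF assms(1)] by (simp add: j2_def)
qed

text \<open>Where \<open>e g + f\<^sup>2\<close> vanishes on a whole slice, \<open>K\<^sub>I\<^sub>I\<close> is undefined and the Weingarten condition is void. The
coefficients of \<open>z\<^sup>2\<close> and \<open>z\<close> in \<open>J\<close> confine this to a single configuration.\<close>

lemma J_vanishing_slice:
  assumes "s \<in> I" "a < b" "\<And>t. t \<in> {a<..<b} \<Longrightarrow> J 1 s t = 0"
  shows "(r1 s)\<^sup>2 = 1/2" "\<omega> s = 1/2"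
proof -
  have "poly (J_poly 1 s) (\<nu> s * cos t - \<omega> s) + \<nu> s * sin t * poly [:j 1 s:] (\<nu> s * cos t - \<omega> s) = 0"
    if "t \<in> {a<..<b}" for t
    using assms(3)[OF that] unfolding J_eq by (simp add: J_poly_def z_def S_def algebra_simps power2_eq_square)
  from affine_trig_poly_eq_0(1)[OF assms(2) \<nu>_nonzero[OF assms(1)] this]
  have "j2 1 s = 0" and j1: "j1 1 s = 0" by (simp_all add: J_poly_def)
  then show X: "(r1 s)\<^sup>2 = 1/2" by (simp add: j2_def)
  show "\<omega> s = 1/2" using j1 unfolding j1_def X by simp
qed

end

section \<open>Variable radius is impossible where eg is negative\<close>

text \<open>Multiplying by \<open>2 d\<^sup>5 G\<close> turns the rational relation into the polynomial \<open>obstruction\<close>.\<close>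

lemma clear_denominators:
  fixes d G X M M' G' :: real
  assumes "d \<noteq> 0" "G \<noteq> 0"
    and eq: "1 + 4 * X\<^sup>2 / d - 2 * (1 - 2 * X) + 8 * (M / (16 * d^3))
       - 3 * ((3 * X - 18 * X\<^sup>2) / d\<^sup>2 - X\<^sup>2 * G' / (d * G)) * (1 - 2 * X)
       = 8 * (- X * (1 - X) / d * (M' * d + 9 * M) / (16 * d^4))"
 shows "2 * d^4 * (d + 4 * X\<^sup>2) * G - 4 * (1 - 2 * X) * d^5 * G + M * d^2 * G
      - 3 * (1 - 2 * X) * (2 * d^3 * (3 * X - 18 * X\<^sup>2) * G - 2 * X\<^sup>2 * G' * d^4)
      + X * (1 - X) * (M' * d + 9 * M) * G = 0" (is "?T = 0")
proof -
  define c a1 a2 a3 a4 a5 where "c = 2 * d^5 * G" and "a1 = 4 * X\<^sup>2 / d"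
    and "a2 = 8 * (M / (16 * d^3))" and "a3 = (3 * X - 18 * X\<^sup>2) / d\<^sup>2"
    and "a4 = X\<^sup>2 * G' / (d * G)" and "a5 = 8 * (- X * (1 - X) / d * (M' * d + 9 * M) / (16 * d^4))"
  have "c * a1 = 2 * d^4 * (4 * X\<^sup>2) * G"
    using assms(1) by (simp add: c_def a1_def eval_nat_numeral)
  moreover have "c * a2 = M * d\<^sup>2 * G"
    using assms(1) by (simp add: c_def a2_def eval_nat_numeral)
  moreover have "c * a3 = 2 * d^3 * (3 * X - 18 * X\<^sup>2) * G"
    using assms(1) by (simp add: c_def a3_def eval_nat_numeral)
  moreover have "c * a4 = 2 * X\<^sup>2 * G' * d^4"
    using assms(1,2) by (simp add: c_def a4_def eval_nat_numeral)
  moreover have "c * a5 = - (X * (1 - X) * (M' * d + 9 * M) * G)"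
    using assms(1) by (simp add: c_def a5_def eval_nat_numeral)
  ultimately have "?T = c * (1 + a1 - 2 * (1 - 2 * X) + a2 - 3 * (a3 - a4) * (1 - 2 * X) - a5)"
    unfolding c_def by algebra
  also have "\<dots> = 0" using eq by (simp add: a1_def a2_def a3_def a4_def a5_def)
  finally show ?thesis .
qed

lemma infinite_image_interval:
  fixes X :: "real \<Rightarrow> real" assumes "a < b" "X a \<noteq> X b" and cont: "continuous_on {a..b} X"
  shows "infinite (X ` {a..b})"
proof
  assume fin: "finite (X ` {a..b})"
  have "connected (X ` {a..b})" using connected_continuous_image[OF cont] by simp
  then have "X ` {a..b} = {} \<or> (\<exists>x. X ` {a..b} = {x})"
    using connected_finite_iff_sing[OF _ ] fin by blast
  moreover have "X a \<in> X ` {a..b}" "X b \<in> X ` {a..b}" using assms by auto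
  ultimately show False using assms(2) by (metis empty_iff singletonD)
qed
lemma nonzero_derivative_endpoints:
  fixes X :: "real \<Rightarrow> real" assumes "a < b" and d: "\<And>s. s \<in> {a..b} \<Longrightarrow> (X has_real_derivative X' s) (at s)"
   "\<And>s. s \<in> {a..b} \<Longrightarrow> X' s \<noteq> 0" 
  shows "X a \<noteq> X b"
proof 
  assume eq: "X a = X b"
  obtain u where "a < u" "u < b" "X b - X a = (b - a) * X' u"
    using MVT2[OF assms(1), of X X'] d(1) by auto
  then show False using eq d(2)[of u] assms(1) by simp
qed

text \<open>With \<open>X = r'\<^sup>2\<close> and \<open>d = 1 - 3 X\<close>, the relations from \<open>z\<^sup>6\<close> and \<open>z\<^sup>5\<close> are solved by \<open>\<omega> = - X / d\<close>,
\<open>j0 = j0_numerator X / (16 d\<^sup>3)\<close> and \<open>\<nu>\<^sup>2 = \<nu>_numerator X / (32 X d\<^sup>3)\<close>. Inserting this into the relation from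
\<open>z\<^sup>4\<close> and clearing denominators leaves \<open>obstruction X = 0\<close>. The polynomial is kept in factored form, since
only its value at \<open>0\<close> matters.\<close>

definition \<nu>_numerator :: "real poly" where "\<nu>_numerator = [:-1, 11, -109, 273, -246:]"
definition j0_numerator :: "real poly" where "j0_numerator = [:-1, 11, -109, 241, -150:]"
definition slope_denominator :: "real poly" where "slope_denominator = [:1, -3:]"

definition obstruction :: "real poly" where
  "obstruction = smult 2 (slope_denominator^4 * (slope_denominator + [:0, 0, 4:]) * \<nu>_numerator) - [:4, -8:] * slope_denominator^5 * \<nu>_numerator
     + j0_numerator * slope_denominator^2 * \<nu>_numerator
     - [:3, -6:] * (smult 2 (slope_denominator^3 * [:0, 3, -18:] * \<nu>_numerator) - [:0, 0, 2:] * pderiv \<nu>_numerator * slope_denominator^4)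
     + [:0, 1, -1:] * (pderiv j0_numerator * slope_denominator + smult 9 j0_numerator) * \<nu>_numerator"

lemma obstruction_nonzero: "obstruction \<noteq> 0"
proof -
  have "poly obstruction 0 = 3"
    by (simp add: obstruction_def \<nu>_numerator_def j0_numerator_def slope_denominator_def pderiv_pCons)
  then show ?thesis by auto
qed

lemma poly_obstruction:
  "poly obstruction x = (let d = 1 - 3 * x; G = poly \<nu>_numerator x; M = poly j0_numerator x in
      2 * d^4 * (d + 4 * x\<^sup>2) * G - 4 * (1 - 2 * x) * d^5 * G + M * d^2 * G
      - 3 * (1 - 2 * x) * (2 * d^3 * (3 * x - 18 * x\<^sup>2) * G - 2 * x\<^sup>2 * poly (pderiv \<nu>_numerator) x * d^4)
      + x * (1 - x) * (poly (pderiv j0_numerator) x * d + 9 * M) * G)"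
proof -
  have v: "poly slope_denominator x = 1 - 3 * x" "poly [:0, 0, 4:] x = 4 * x\<^sup>2" "poly [:4, -8:] x = 4 * (1 - 2 * x)"
    "poly [:3, -6:] x = 3 * (1 - 2 * x)" "poly [:0, 3, -18:] x = 3 * x - 18 * x\<^sup>2"
    "poly [:0, 0, 2:] x = 2 * x\<^sup>2" "poly [:0, 1, -1:] x = x * (1 - x)"
    by (simp_all add: slope_denominator_def power2_eq_square algebra_simps)
  show ?thesis
    unfolding obstruction_def poly_add poly_diff poly_mult poly_power poly_smult v Let_def
    by (simp only: mult.assoc mult.left_commute)
qed

context canal_profile
begin

text \<open>The relation from \<open>z\<^sup>6\<close> reads \<open>X + \<omega> (1 - 3 X) = 0\<close> for \<open>X = r'\<^sup>2\<close>. It determines \<open>\<omega>\<close>, and with it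
\<open>X' = 2 (r' / r) (1 - X) \<omega>\<close>, which is nonzero since \<open>0 < X < 1\<close>. All quantities below are therefore functions
of \<open>X\<close> on an open set of parameters, and their derivatives follow from the chain rule.\<close>

lemma no_indefinite_family:
  assumes V: "open V" "V \<subseteq> I" "s0 \<in> V"
    and r1_nz: "\<And>s. s \<in> V \<Longrightarrow> r1 s \<noteq> 0"
    and \<tau>0: "\<And>s. s \<in> V \<Longrightarrow> \<tau> s = 0"
    and even0: "\<And>s. s \<in> V \<Longrightarrow> even_part 1 s = 0"
  shows False
proof -
  define X where "X s = (r1 s)\<^sup>2" for s
  define \<rho> where "\<rho> s = r1 s / r s" for s
  have VI: "s \<in> I" if "s \<in> V" for s using that V by auto
  have X_pos: "X s > 0" "X s < 1" if "s \<in> V" for s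
    using r1_nz[OF that] r1_less[OF VI[OF that]] by (simp_all add: X_def)
  have \<rho>_nz: "\<rho> s \<noteq> 0" if "s \<in> V" for s
    using r1_nz[OF that] r_nonzero[OF VI[OF that]] by (simp add: \<rho>_def)
  have rr: "r1 s * r2 s = \<rho> s * (1 - X s) * \<omega> s" for s
    by (simp add: r2_def \<rho>_def p_def X_def)
  have cancel: "a = b" if "2 * \<rho> s * a = 2 * \<rho> s * b" "s \<in> V" for a b s
    using that \<rho>_nz[OF that(2)] by simp
  have rel6: "X s + \<omega> s * (1 - 3 * X s) = 0" if "s \<in> V" for s
  proof -
    have "4 * \<rho> s * (X s + \<omega> s * (1 - 3 * X s)) = 0"
      using even_part_coeff_indefinite(1)[OF \<tau>0[OF that] even0[OF that]] rr[of s]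
      unfolding j1_def j2_def j2'_def \<rho>_def[symmetric] X_def[symmetric] by algebra
    then show ?thesis using \<rho>_nz[OF that] by simp
  qed
  have d_nz: "1 - 3 * X s \<noteq> 0" if "s \<in> V" for s
    using rel6[OF that] X_pos[OF that] by auto
  have \<omega>_eq: "\<omega> s = - X s / (1 - 3 * X s)" if "s \<in> V" for s
    using rel6[OF that] d_nz[OF that] by (simp add: field_simps)
  define Xd where "Xd s = - X s * (1 - X s) / (1 - 3 * X s)" for s
  \<comment> \<open>The factor \<open>2 r' / r\<close> is split off because it is common to all terms of the three relations.\<close>
  have X_deriv: "(X has_real_derivative 2 * \<rho> s * Xd s) (at s)" if "s \<in> V" for s
  proof -
    have "(X has_real_derivative 2 * (r1 s * r2 s)) (at s)"
      unfolding X_def using that VI by (auto intro!: derivative_eq_intros r1_deriv')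
    moreover have "2 * (r1 s * r2 s) = 2 * \<rho> s * Xd s"
      unfolding rr by (simp add: \<omega>_eq[OF that] Xd_def)
    ultimately show ?thesis by simp
  qed
  \<comment> \<open>Identities on the open set \<open>V\<close> may be differentiated.\<close>
  have transfer: "D = d" if "s \<in> V" "\<And>u. u \<in> V \<Longrightarrow> F u = G u"
     "(F has_real_derivative D) (at s)" "(G has_real_derivative d) (at s)" for F G :: "real \<Rightarrow> real" and D d s
    using has_field_derivative_transform_within_open[OF that(3) V(1) that(1,2)] that(4) DERIV_unique by blast
  have j1_eq: "j1 1 s = 1 + 4 * (X s)\<^sup>2 / (1 - 3 * X s)" if "s \<in> V" for s
    by (simp add: j1_def \<omega>_eq[OF that] X_def power2_eq_square)
  have j1'_eq: "j1' 1 s = 2 * \<rho> s * Xd s * (8 * X s - 12 * (X s)\<^sup>2) / (1 - 3 * X s)\<^sup>2" if "s \<in> V" for s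
  proof (rule transfer[OF that j1_eq j_deriv(3)[OF VI[OF that]]])
    show "((\<lambda>u. 1 + 4 * (X u)\<^sup>2 / (1 - 3 * X u)) has_real_derivative
       2 * \<rho> s * Xd s * (8 * X s - 12 * (X s)\<^sup>2) / (1 - 3 * X s)\<^sup>2) (at s)"
      using d_nz[OF that]
      by (auto intro!: derivative_eq_intros X_deriv[OF that])
        (simp add: power2_eq_square divide_simps, simp add: algebra_simps)
  qed
  have j2'_eq: "j2' 1 s = - 4 * \<rho> s * Xd s" if "s \<in> V" for s
  proof -
    have "j2' 1 s = - 4 * (r1 s * r2 s)" by (simp add: j2'_def)
    then show ?thesis unfolding rr by (simp add: \<omega>_eq[OF that] Xd_def)
  qed
  have j2_eq: "j2 1 s = 1 - 2 * X s" for s by (simp add: j2_def X_def)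
  have j0_eq: "j0 1 s = poly j0_numerator (X s) / (16 * (1 - 3 * X s)^3)" if "s \<in> V" for s
  proof -
    have "2 * \<rho> s * (- 11 * j2 1 s + 12 * j1 1 s + 16 * j0 1 s) =
      2 * \<rho> s * (8 * (Xd s * (8 * X s - 12 * (X s)\<^sup>2) / (1 - 3 * X s)\<^sup>2) - 24 * Xd s)"
      using even_part_coeff_indefinite(2)[OF \<tau>0[OF that] even0[OF that]]
      unfolding j1'_eq[OF that] j2'_eq[OF that] \<rho>_def[symmetric] by (simp add: algebra_simps)
    then have "- 11 * j2 1 s + 12 * j1 1 s + 16 * j0 1 s =
      8 * (Xd s * (8 * X s - 12 * (X s)\<^sup>2) / (1 - 3 * X s)\<^sup>2) - 24 * Xd s"
      using \<rho>_nz[OF that] by simp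
    then have "16 * j0 1 s = 8 * (Xd s * (8 * X s - 12 * (X s)\<^sup>2) / (1 - 3 * X s)\<^sup>2) - 24 * Xd s
        + 11 * (1 - 2 * X s) - 12 * (1 + 4 * (X s)\<^sup>2 / (1 - 3 * X s))"
      unfolding j1_eq[OF that] j2_eq by simp
    also have "\<dots> = poly j0_numerator (X s) / (1 - 3 * X s)^3"
      using d_nz[OF that] unfolding Xd_def j0_numerator_def
      by (simp add: divide_simps) (simp add: algebra_simps eval_nat_numeral)
    finally show ?thesis by simp
  qed
  have j0'_eq: "j0' 1 s = 2 * \<rho> s * Xd s * (poly (pderiv j0_numerator) (X s) * (1 - 3 * X s) + 9 * poly j0_numerator (X s))
      / (16 * (1 - 3 * X s)^4)" if "s \<in> V" for s
  proof (rule transfer[OF that j0_eq j_deriv(4)[OF VI[OF that]]])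
    show "((\<lambda>u. poly j0_numerator (X u) / (16 * (1 - 3 * X u)^3)) has_real_derivative
       2 * \<rho> s * Xd s * (poly (pderiv j0_numerator) (X s) * (1 - 3 * X s) + 9 * poly j0_numerator (X s))
      / (16 * (1 - 3 * X s)^4)) (at s)"
      using d_nz[OF that]
      by (auto intro!: derivative_eq_intros X_deriv[OF that] DERIV_chain2[OF poly_DERIV])
        (simp add: divide_simps, simp add: algebra_simps eval_nat_numeral)
  qed
  have L_eq: "(\<nu> s)\<^sup>2 = poly \<nu>_numerator (X s) / (32 * X s * (1 - 3 * X s)^3)" if "s \<in> V" for s
  proof -
    have "j0 1 s = 2 * X s * ((\<nu> s)\<^sup>2 - (\<omega> s)\<^sup>2)"
      by (simp add: j0_def \<tau>0[OF that] X_def)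
    then have "(\<nu> s)\<^sup>2 = j0 1 s / (2 * X s) + (\<omega> s)\<^sup>2"
      using X_pos[OF that] by simp
    also have "\<dots> = poly j0_numerator (X s) / (16 * (1 - 3 * X s)^3) / (2 * X s) + (X s / (1 - 3 * X s))\<^sup>2"
      unfolding j0_eq[OF that] \<omega>_eq[OF that] by simp
    also have "\<dots> = poly \<nu>_numerator (X s) / (32 * X s * (1 - 3 * X s)^3)"
      using X_pos[OF that] d_nz[OF that] unfolding \<nu>_numerator_def j0_numerator_def
      by (simp add: divide_simps) (simp add: algebra_simps eval_nat_numeral)
    finally show ?thesis .
  qed
  have \<nu>_numerator_nonzero: "poly \<nu>_numerator (X s) \<noteq> 0" if "s \<in> V" for s
    using L_eq[OF that] \<nu>_nonzero[OF VI[OF that]] by auto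
  have L': "2 * \<nu> s * \<nu>1 s = 2 * \<rho> s * Xd s *
      (X s * (1 - 3 * X s) * poly (pderiv \<nu>_numerator) (X s) - poly \<nu>_numerator (X s) * (1 - 12 * X s))
      / (32 * (X s)\<^sup>2 * (1 - 3 * X s)^4)" if "s \<in> V" for s
  proof (rule transfer[OF that L_eq])
    show "((\<lambda>u. (\<nu> u)\<^sup>2) has_real_derivative 2 * \<nu> s * \<nu>1 s) (at s)"
      by (auto intro!: derivative_eq_intros \<nu>_deriv VI that)
    show "((\<lambda>u. poly \<nu>_numerator (X u) / (32 * X u * (1 - 3 * X u)^3)) has_real_derivative
      2 * \<rho> s * Xd s * (X s * (1 - 3 * X s) * poly (pderiv \<nu>_numerator) (X s) - poly \<nu>_numerator (X s) * (1 - 12 * X s))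
      / (32 * (X s)\<^sup>2 * (1 - 3 * X s)^4)) (at s)"
      using d_nz[OF that] X_pos[OF that]
      by (auto intro!: derivative_eq_intros X_deriv[OF that] DERIV_chain2[OF poly_DERIV])
        (simp add: divide_simps, simp add: algebra_simps eval_nat_numeral)
  qed
  have h1_eq: "h1 s = (3 * X s - 18 * (X s)\<^sup>2) / (1 - 3 * X s)\<^sup>2
      - (X s)\<^sup>2 * poly (pderiv \<nu>_numerator) (X s) / ((1 - 3 * X s) * poly \<nu>_numerator (X s))" if "s \<in> V" for s
  proof -
    have "\<beta> s * (\<nu>1 s / \<nu> s) = X s / (\<rho> s * (1 - X s)) * (2 * \<nu> s * \<nu>1 s) / (2 * (\<nu> s)\<^sup>2)"
      using r_nonzero[OF VI[OF that]] r1_nz[OF that] \<nu>_nonzero[OF VI[OF that]] p_nonzero[OF VI[OF that]]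
      unfolding \<beta>_def \<rho>_def X_def p_def by (simp add: field_simps power2_eq_square)
    also have "\<dots> = Xd s / (1 - X s) *
      (X s * (1 - 3 * X s) * poly (pderiv \<nu>_numerator) (X s) - poly \<nu>_numerator (X s) * (1 - 12 * X s))
       / ((1 - 3 * X s) * poly \<nu>_numerator (X s))"
      using X_pos[OF that] d_nz[OF that] \<nu>_numerator_nonzero[OF that] \<rho>_nz[OF that]
      unfolding L'[OF that] unfolding L_eq[OF that]
      by (simp add: divide_simps eval_nat_numeral)
    also have "\<dots> = - X s * (X s * (1 - 3 * X s) * poly (pderiv \<nu>_numerator) (X s) - poly \<nu>_numerator (X s) * (1 - 12 * X s))
       / ((1 - 3 * X s)\<^sup>2 * poly \<nu>_numerator (X s))"
      using X_pos[OF that] d_nz[OF that] \<nu>_numerator_nonzero[OF that]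
      unfolding Xd_def by (simp add: divide_simps power2_eq_square)
    finally have "h1 s = - X s * (X s * (1 - 3 * X s) * poly (pderiv \<nu>_numerator) (X s)
       - poly \<nu>_numerator (X s) * (1 - 12 * X s)) / ((1 - 3 * X s)\<^sup>2 * poly \<nu>_numerator (X s)) + 2 * (X s / (1 - 3 * X s))"
      unfolding h1_def \<omega>_eq[OF that] by simp
    also have "\<dots> = (3 * X s - 18 * (X s)\<^sup>2) / (1 - 3 * X s)\<^sup>2
      - (X s)\<^sup>2 * poly (pderiv \<nu>_numerator) (X s) / ((1 - 3 * X s) * poly \<nu>_numerator (X s))"
      using d_nz[OF that] \<nu>_numerator_nonzero[OF that]
      by (simp add: divide_simps) (simp add: algebra_simps eval_nat_numeral)
    finally show ?thesis .
  qed
  have root: "poly obstruction (X s) = 0" if "s \<in> V" for s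
  proof -
    have "2 * \<rho> s * (j2 1 s * (- 5/2 - 3 * h1 s) + 3 * j1 1 s + 32 * j0 1 s)
       = 8 * j0' 1 s + 12 * j1' 1 s + 2 * j2' 1 s"
      using even_part_coeff_indefinite(3)[OF \<tau>0[OF that] even0[OF that]] by (simp add: \<rho>_def)
    moreover have "2 * \<rho> s * (j1 1 s - j2 1 s) = j2' 1 s"
      "2 * \<rho> s * (- 11 * j2 1 s + 12 * j1 1 s + 16 * j0 1 s) = 8 * j1' 1 s + 12 * j2' 1 s"
      using even_part_coeff_indefinite(1,2)[OF \<tau>0[OF that] even0[OF that]] by (simp_all add: \<rho>_def)
    ultimately have "2 * \<rho> s * (j1 1 s - 2 * j2 1 s + 8 * j0 1 s - 3 * h1 s * j2 1 s) = 8 * j0' 1 s"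
      by algebra
    then have "2 * \<rho> s * (j1 1 s - 2 * j2 1 s + 8 * j0 1 s - 3 * h1 s * j2 1 s) = 2 * \<rho> s * (8 *
       (Xd s * (poly (pderiv j0_numerator) (X s) * (1 - 3 * X s) + 9 * poly j0_numerator (X s)) / (16 * (1 - 3 * X s)^4)))"
      unfolding j0'_eq[OF that] by simp
    then have eq: "j1 1 s - 2 * j2 1 s + 8 * j0 1 s - 3 * h1 s * j2 1 s = 
       8 * (Xd s * (poly (pderiv j0_numerator) (X s) * (1 - 3 * X s) + 9 * poly j0_numerator (X s)) / (16 * (1 - 3 * X s)^4))"
      using that by (rule cancel)
    define d G G' M M' where "d = 1 - 3 * X s" and "G = poly \<nu>_numerator (X s)" and "G' = poly (pderiv \<nu>_numerator) (X s)"
      and "M = poly j0_numerator (X s)" and "M' = poly (pderiv j0_numerator) (X s)"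
    have nz: "d \<noteq> 0" "G \<noteq> 0" using d_nz[OF that] \<nu>_numerator_nonzero[OF that] by (simp_all add: d_def G_def)
    from eq have "1 + 4 * (X s)\<^sup>2 / d - 2 * (1 - 2 * X s) + 8 * (M / (16 * d^3))
       - 3 * ((3 * X s - 18 * (X s)\<^sup>2) / d\<^sup>2 - (X s)\<^sup>2 * G' / (d * G)) * (1 - 2 * X s)
       = 8 * (- X s * (1 - X s) / d * (M' * d + 9 * M) / (16 * d^4))"
      unfolding j1_eq[OF that] j2_eq j0_eq[OF that] h1_eq[OF that] Xd_def
        d_def[symmetric] G_def[symmetric] G'_def[symmetric] M_def[symmetric] M'_def[symmetric] .
    then have "2 * d^4 * (d + 4 * (X s)\<^sup>2) * G - 4 * (1 - 2 * X s) * d^5 * G + M * d^2 * G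
      - 3 * (1 - 2 * X s) * (2 * d^3 * (3 * X s - 18 * (X s)\<^sup>2) * G - 2 * (X s)\<^sup>2 * G' * d^4)
      + X s * (1 - X s) * (M' * d + 9 * M) * G = 0"
      by (rule clear_denominators[OF nz])
    then show ?thesis
      unfolding poly_obstruction Let_def d_def G_def G'_def M_def M'_def .
  qed
  from V(1,3) obtain \<epsilon> where \<epsilon>: "\<epsilon> > 0" "ball s0 \<epsilon> \<subseteq> V"
    unfolding open_contains_ball by blast
  have sub: "s \<in> V" if "s \<in> {s0..s0 + \<epsilon>/2}" for s
  proof -
    have "s \<in> ball s0 \<epsilon>" using that \<epsilon>(1) by (simp add: dist_real_def)
    then show ?thesis using \<epsilon>(2) by blast
  qed
  have Xs_nz: "2 * \<rho> s * Xd s \<noteq> 0" if "s \<in> V" for s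
    using \<rho>_nz[OF that] X_pos[OF that] d_nz[OF that] by (simp add: Xd_def)
  have cont: "continuous_on {s0..s0 + \<epsilon>/2} X"
    using DERIV_isCont[OF X_deriv[OF sub]] by (intro continuous_at_imp_continuous_on ballI)
  have less: "s0 < s0 + \<epsilon>/2" using \<epsilon>(1) by simp
  have "X s0 \<noteq> X (s0 + \<epsilon>/2)"
    by (rule nonzero_derivative_endpoints[OF less X_deriv[OF sub] Xs_nz[OF sub]])
  then have "infinite (X ` {s0..s0 + \<epsilon>/2})"
    by (rule infinite_image_interval[OF less _ cont])
  moreover have "X ` {s0..s0 + \<epsilon>/2} \<subseteq> {x. poly obstruction x = 0}"
    using root[OF sub] by blast
  ultimately show False
    using finite_subset[OF _ poly_roots_finite[OF obstruction_nonzero]] by blast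
qed

end

section \<open>Curvatures of a surface in normal form\<close>

text \<open>The shape of the first determinant in the formula for \<open>K\<^sub>I\<^sub>I\<close>; the second one is the case
\<open>a = 0\<close>, \<open>b = d\<close>, \<open>c = k\<close>.\<close>

lemma det_symmetric_minor:
  "det (vector [vector [a, b, c], vector [d, e, f], vector [k, f, g]] :: real^3^3)
    = a * (e * g - f\<^sup>2) - b * (d * g - f * k) + c * (d * f - e * k)"
  by (simp add: det_3 vector_def power2_eq_square algebra_simps)

text \<open>The sign \<open>sgn (1 + z)\<close> is that of the unit normal. It is \<open>0\<close> at singular points, so the formulas for the second
fundamental form hold there as well.\<close>

locale canal_profile_surface = canal_profile +
  fixes C :: "real \<Rightarrow> real \<Rightarrow> real^3"
  assumes sf_e: "s \<in> I \<Longrightarrow> sf_e C s t = sgn (1 + z s t) * e s t"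
    and sf_f: "s \<in> I \<Longrightarrow> sf_f C s t = sgn (1 + z s t) * f s t"
    and sf_g: "s \<in> I \<Longrightarrow> sf_g C s t = sgn (1 + z s t) * g s t"
    and area: "s \<in> I \<Longrightarrow> ff_E C s t * ff_G C s t - (ff_F C s t)\<^sup>2 = (r s * p s * (1 + z s t))\<^sup>2"
begin

text \<open>At a regular point the sign of the normal is locally constant and can be taken out of a derivative.\<close>

lemma partial_s_sgn:
  assumes s: "s \<in> I" and nz: "1 + z s t \<noteq> 0"
    and F: "\<And>u. u \<in> I \<Longrightarrow> 1 + z u t \<noteq> 0 \<Longrightarrow> F u t = sgn (1 + z u t) * \<phi> u t"
    and d: "((\<lambda>u. \<phi> u t) has_real_derivative d) (at s)"
  shows "partial_s F s t = sgn (1 + z s t) * d"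
proof (rule partial_s_eqI[where \<phi> = "\<lambda>u. sgn (1 + z s t) * \<phi> u t"])
  have "isCont (\<lambda>u. 1 + z u t) s"
    by (intro continuous_intros DERIV_isCont[OF z_deriv_s[OF s]])
  from eventually_sgn_eq[OF this nz] eventually_nhds_in_open[OF open_I s]
  show "eventually (\<lambda>u. F u t = sgn (1 + z s t) * \<phi> u t) (nhds s)"
  proof eventually_elim
    case (elim u)
    then have "1 + z u t \<noteq> 0" using nz by (metis sgn_eq_0_iff)
    with F[of u] elim show ?case by simp
  qed
qed (rule DERIV_cmult[OF d])

lemma partial_t_sgn:
  assumes nz: "1 + z s t \<noteq> 0"
    and F: "\<And>v. 1 + z s v \<noteq> 0 \<Longrightarrow> F s v = sgn (1 + z s v) * \<phi> s v"
    and d: "((\<lambda>v. \<phi> s v) has_real_derivative d) (at t)"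
  shows "partial_t F s t = sgn (1 + z s t) * d"
proof (rule partial_t_eqI[where \<phi> = "\<lambda>v. sgn (1 + z s t) * \<phi> s v"])
  have "isCont (\<lambda>v. 1 + z s v) t"
    by (intro continuous_intros DERIV_isCont[OF z_deriv_t])
  from eventually_sgn_eq[OF this nz]
  show "eventually (\<lambda>v. F s v = sgn (1 + z s t) * \<phi> s v) (nhds t)"
  proof eventually_elim
    case (elim v)
    then have "1 + z s v \<noteq> 0" using nz by (metis sgn_eq_0_iff)
    with F[of v] elim show ?case by simp
  qed
qed (rule DERIV_cmult[OF d])

lemma sf_partials:
  assumes s: "s \<in> I" and nz: "1 + z s t \<noteq> 0"
  shows "partial_s (sf_e C) s t = sgn (1 + z s t) * es s t"
    "partial_t (sf_e C) s t = sgn (1 + z s t) * et s t"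
    "partial_s (sf_f C) s t = sgn (1 + z s t) * fs s t"
    "partial_t (sf_f C) s t = sgn (1 + z s t) * ft s t"
    "partial_s (sf_g C) s t = sgn (1 + z s t) * gs s t"
    "partial_t (sf_g C) s t = 0"
proof -
  show "partial_s (sf_e C) s t = sgn (1 + z s t) * es s t"
    by (rule partial_s_sgn[where F = "sf_e C" and \<phi> = e, OF s nz _ e_deriv_s[OF s]]) (rule sf_e)
  show "partial_t (sf_e C) s t = sgn (1 + z s t) * et s t"
    by (rule partial_t_sgn[where F = "sf_e C" and \<phi> = e, OF nz _ e_deriv_t[OF s]]) (rule sf_e[OF s])
  show "partial_s (sf_f C) s t = sgn (1 + z s t) * fs s t"
    by (rule partial_s_sgn[where F = "sf_f C" and \<phi> = f, OF s nz _ f_deriv_s[OF s]]) (rule sf_f)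
  show "partial_t (sf_f C) s t = sgn (1 + z s t) * ft s t"
    by (rule partial_t_sgn[where F = "sf_f C" and \<phi> = f, OF nz _ f_deriv_t]) (rule sf_f[OF s])
  show "partial_s (sf_g C) s t = sgn (1 + z s t) * gs s t"
    by (rule partial_s_sgn[where F = "sf_g C" and \<phi> = g, OF s nz _ g_deriv_s[OF s]]) (rule sf_g)
  have "partial_t (sf_g C) s t = sgn (1 + z s t) * 0"
    by (rule partial_t_sgn[where F = "sf_g C" and \<phi> = g, OF nz _ g_deriv_t]) (rule sf_g[OF s])
  then show "partial_t (sf_g C) s t = 0" by simp
qed

lemma sf_second_partials:
  assumes s: "s \<in> I" and nz: "1 + z s t \<noteq> 0"
  shows "partial_t (partial_t (sf_e C)) s t = sgn (1 + z s t) * ett s t"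
    "partial_t (partial_s (sf_f C)) s t = sgn (1 + z s t) * f_st s t"
    "partial_s (partial_s (sf_g C)) s t = sgn (1 + z s t) * gss s t"
proof -
  show "partial_t (partial_t (sf_e C)) s t = sgn (1 + z s t) * ett s t"
    by (rule partial_t_sgn[where F = "partial_t (sf_e C)" and \<phi> = et, OF nz _ et_deriv_t[OF s]])
      (rule sf_partials(2)[OF s])
  show "partial_t (partial_s (sf_f C)) s t = sgn (1 + z s t) * f_st s t"
    by (rule partial_t_sgn[where F = "partial_s (sf_f C)" and \<phi> = fs, OF nz _ fs_deriv_t])
      (rule sf_partials(3)[OF s])
  show "partial_s (partial_s (sf_g C)) s t = sgn (1 + z s t) * gss s t"
    by (rule partial_s_sgn[where F = "partial_s (sf_g C)" and \<phi> = gs, OF s nz _ gs_deriv_s[OF s]])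
      (rule sf_partials(5))
qed

lemma eg_eq: "s \<in> I \<Longrightarrow> e s t * g s t = (p s)\<^sup>2 * (w s t + (y s t)\<^sup>2)"
  using r_nonzero by (simp add: e_def g_def w_def power2_eq_square field_simps)

lemma eg_f_eq: "s \<in> I \<Longrightarrow> e s t * g s t - (f s t)\<^sup>2 = (p s)\<^sup>2 * w s t"
  unfolding eg_eq by (simp add: f_def power2_eq_square algebra_simps)

lemma sf_products:
  assumes s: "s \<in> I" and nz: "1 + z s t \<noteq> 0"
  shows "sf_e C s t * sf_g C s t = e s t * g s t" "(sf_f C s t)\<^sup>2 = (f s t)\<^sup>2"
proof -
  have "sgn (1 + z s t) = 1 \<or> sgn (1 + z s t) = -1" using nz by (simp add: sgn_if)
  then show "sf_e C s t * sf_g C s t = e s t * g s t" "(sf_f C s t)\<^sup>2 = (f s t)\<^sup>2"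
    unfolding sf_e[OF s] sf_f[OF s] sf_g[OF s] by auto
qed

text \<open>At points where \<open>e g = 0\<close> the absolute value in \<open>K\<^sub>I\<^sub>I\<close> need not be differentiable; they lie in no region.\<close>

definition region :: "real \<Rightarrow> real \<Rightarrow> real \<Rightarrow> bool" where
  "region l s t \<longleftrightarrow> 1 + z s t \<noteq> 0 \<and>
     (l = 0 \<and> w s t + (y s t)\<^sup>2 > 0 \<or> l = 1 \<and> w s t + (y s t)\<^sup>2 < 0)"

lemma abs_eg_f_eq:
  assumes s: "s \<in> I" and reg: "region l s t"
  shows "(\<bar>e s t * g s t\<bar> - (f s t)\<^sup>2)\<^sup>2 = ((p s)\<^sup>2 * J l s t)\<^sup>2"
proof -
  have "\<bar>e s t * g s t\<bar> = (p s)\<^sup>2 * \<bar>w s t + (y s t)\<^sup>2\<bar>"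
    unfolding eg_eq[OF s] by (simp add: abs_mult)
  moreover have "\<bar>w s t + (y s t)\<^sup>2\<bar> = w s t + (y s t)\<^sup>2 \<and> l = 0 \<or>
      \<bar>w s t + (y s t)\<^sup>2\<bar> = - (w s t + (y s t)\<^sup>2) \<and> l = 1"
    using reg by (auto simp: region_def)
  ultimately consider
      "\<bar>e s t * g s t\<bar> - (f s t)\<^sup>2 = (p s)\<^sup>2 * J l s t"
    | "\<bar>e s t * g s t\<bar> - (f s t)\<^sup>2 = - ((p s)\<^sup>2 * J l s t)"
    by (auto simp: J_def f_def power_mult_distrib algebra_simps)
  then show ?thesis by cases simp_all
qed

lemma gaussian_curvature_eq:
  assumes s: "s \<in> I" and nz: "1 + z s t \<noteq> 0"
  shows "gaussian_curvature C s t = Gauss s t"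
  using nz r_nonzero[OF s] p_nonzero[OF s]
  unfolding gaussian_curvature_def sf_products[OF s nz] eg_f_eq[OF s] area[OF s] Gauss_def w_def
  by (simp add: divide_simps) (simp add: power2_eq_square algebra_simps)

lemma second_gaussian_curvature_eq:
  assumes s: "s \<in> I" and reg: "region l s t"
  shows "second_gaussian_curvature C s t = sgn (1 + z s t) * SecondGauss l s t"
proof -
  have nz: "1 + z s t \<noteq> 0" using reg by (simp add: region_def)
  define \<eta> where "\<eta> = sgn (1 + z s t)"
  have \<eta>: "\<eta> = 1 \<or> \<eta> = -1" using nz by (auto simp: \<eta>_def sgn_if)
  define N where "N = (- (1/2) * ett s t + f_st s t - (1/2) * gss s t) * (e s t * g s t - (f s t)\<^sup>2)
     - (1/2) * es s t * (ft s t - (1/2) * gs s t) * g s t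
     + (fs s t - (1/2) * et s t) * (ft s t - (1/2) * gs s t) * f s t
     + (1/4) * (et s t)\<^sup>2 * g s t - (1/2) * et s t * gs s t * f s t + (1/4) * e s t * (gs s t)\<^sup>2"
  have "second_gaussian_curvature C s t = 1 / (\<bar>e s t * g s t\<bar> - (f s t)\<^sup>2)\<^sup>2 * (\<eta> * N)"
    unfolding second_gaussian_curvature_def Let_def sf_products[OF s nz] sf_partials[OF s nz]
      sf_second_partials[OF s nz] det_symmetric_minor sf_e[OF s] sf_f[OF s] sf_g[OF s] \<eta>_def[symmetric] N_def
    using \<eta> by (auto simp: power2_eq_square algebra_simps)
  also have "\<dots> = \<eta> * SecondGauss l s t"
    unfolding N_def brioschi_numerator[OF s] abs_eg_f_eq[OF s reg] SecondGauss_def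
    using p_nonzero[OF s] r_nonzero[OF s] by (simp add: power_mult_distrib)
  finally show ?thesis by (simp add: \<eta>_def)
qed

lemma w_y_cont_s: "s \<in> I \<Longrightarrow> isCont (\<lambda>u. w u t + (y u t)\<^sup>2) s"
  unfolding w_def by (intro continuous_intros DERIV_isCont[OF z_deriv_s] DERIV_isCont[OF y_deriv_s])

lemma w_y_cont_t: "isCont (\<lambda>v. w s v + (y s v)\<^sup>2) t"
  unfolding w_def by (intro continuous_intros DERIV_isCont[OF z_deriv_t] DERIV_isCont[OF y_deriv_t])

lemma region_cong:
  assumes "sgn (1 + z u v) = sgn (1 + z s t)"
    "sgn (w u v + (y u v)\<^sup>2) = sgn (w s t + (y s t)\<^sup>2)" "region l s t"
  shows "region l u v"
proof -
  have "1 + z u v \<noteq> 0 \<longleftrightarrow> 1 + z s t \<noteq> 0" using assms(1) by (metis sgn_eq_0_iff)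
  moreover have "0 < w u v + (y u v)\<^sup>2 \<longleftrightarrow> 0 < w s t + (y s t)\<^sup>2"
    using assms(2) by (metis sgn_greater)
  moreover have "w u v + (y u v)\<^sup>2 < 0 \<longleftrightarrow> w s t + (y s t)\<^sup>2 < 0"
    using assms(2) by (metis sgn_less)
  ultimately show ?thesis using assms(3) by (simp add: region_def)
qed

lemma region_nonzero:
  assumes "region l s t" shows "1 + z s t \<noteq> 0" "w s t + (y s t)\<^sup>2 \<noteq> 0"
  using assms by (auto simp: region_def)

lemma eventually_region_s:
  assumes "s \<in> I" "region l s t"
  shows "eventually (\<lambda>u. u \<in> I \<and> region l u t \<and> sgn (1 + z u t) = sgn (1 + z s t)) (nhds s)"
proof -
  have "isCont (\<lambda>u. 1 + z u t) s"
    by (intro continuous_intros DERIV_isCont[OF z_deriv_s[OF assms(1)]])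
  from eventually_sgn_eq[OF this region_nonzero(1)[OF assms(2)]]
    eventually_sgn_eq[OF w_y_cont_s[OF assms(1)] region_nonzero(2)[OF assms(2)]]
    eventually_nhds_in_open[OF open_I assms(1)]
  show ?thesis by eventually_elim (auto intro: region_cong assms(2))
qed

lemma eventually_region_t:
  assumes "region l s t"
  shows "eventually (\<lambda>v. region l s v \<and> sgn (1 + z s v) = sgn (1 + z s t)) (nhds t)"
proof -
  have "isCont (\<lambda>v. 1 + z s v) t"
    by (intro continuous_intros DERIV_isCont[OF z_deriv_t])
  from eventually_sgn_eq[OF this region_nonzero(1)[OF assms]]
    eventually_sgn_eq[OF w_y_cont_t region_nonzero(2)[OF assms]]
  show ?thesis by eventually_elim (auto intro: region_cong assms)
qed

lemma jacobi_polynomial_surface: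
  assumes s: "s \<in> I" and reg: "region l s t" and J: "J l s t \<noteq> 0"
    and jac: "jacobi_function (gaussian_curvature C) (second_gaussian_curvature C) s t = 0"
  shows "poly (odd_part l s) (z s t) + S s t * poly (even_part l s) (z s t) = 0"
proof (rule jacobi_polynomial[OF s region_nonzero(1)[OF reg] J])
  note nz = region_nonzero(1)[OF reg]
  have evKs: "eventually (\<lambda>u. gaussian_curvature C u t = Gauss u t) (nhds s)"
    using eventually_region_s[OF s reg]
    by eventually_elim (use gaussian_curvature_eq region_nonzero(1) in blast)
  have evKt: "eventually (\<lambda>v. gaussian_curvature C s v = Gauss s v) (nhds t)"
    using eventually_region_t[OF reg]
    by eventually_elim (use gaussian_curvature_eq[OF s] region_nonzero(1) in blast)
  have evLs: "eventually (\<lambda>u. second_gaussian_curvature C u t = sgn (1 + z s t) * SecondGauss l u t) (nhds s)"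
    using eventually_region_s[OF s reg]
    by eventually_elim (use second_gaussian_curvature_eq in metis)
  have evLt: "eventually (\<lambda>v. second_gaussian_curvature C s v = sgn (1 + z s t) * SecondGauss l s v) (nhds t)"
    using eventually_region_t[OF reg]
    by eventually_elim (use second_gaussian_curvature_eq[OF s] in metis)
  note K = partial_s_eqI[where F = "gaussian_curvature C" and \<phi> = "\<lambda>u. Gauss u t", OF evKs Gauss_deriv_s[OF s nz]]
    partial_t_eqI[where F = "gaussian_curvature C" and \<phi> = "Gauss s", OF evKt Gauss_deriv_t[OF s nz]]
  note L = partial_s_eqI[where F = "second_gaussian_curvature C"
      and \<phi> = "\<lambda>u. sgn (1 + z s t) * SecondGauss l u t",
      OF evLs DERIV_cmult[OF SecondGauss_deriv_s[OF s J]]]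
    partial_t_eqI[where F = "second_gaussian_curvature C"
      and \<phi> = "\<lambda>v. sgn (1 + z s t) * SecondGauss l s v",
      OF evLt DERIV_cmult[OF SecondGauss_deriv_t[OF s J]]]
  have distr: "a * (\<eta> * b) - c * (\<eta> * d) = \<eta> * (a * b - c * d)" for a b c d \<eta> :: real
    by (simp add: algebra_simps)
  show "(zs s t - 2 * (r1 s / r s) * w s t) / ((r s)\<^sup>2 * (1 + z s t)\<^sup>2)
        * ((2 * H s t * Jt l s t - Ht s t * J l s t) / (4 * r s * (J l s t)^3))
      - (- S s t / ((r s)\<^sup>2 * (1 + z s t)\<^sup>2))
        * ((r1 s / r s * H s t * J l s t - Hs s t * J l s t + 2 * H s t * Js l s t)
            / (4 * r s * (J l s t)^3)) = 0" (is "?E = 0")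
  proof -
    have "sgn (1 + z s t) * ?E = 0"
      using jac unfolding jacobi_function_def K L distr .
    then show ?thesis using nz by (simp only: mult_eq_0_iff sgn_eq_0_iff) simp
  qed
qed

end

locale weingarten_profile_surface = canal_profile_surface +
  fixes D :: "(real \<times> real) set"
  assumes open_D: "open D" and fst_D: "fst ` D = I"
    and regular_D: "regular_on D C" and nondegenerate_D: "II_nondegenerate_on D C"
    and weingarten_D: "weingarten_on (second_gaussian_curvature_domain D C)
                       (gaussian_curvature C) (second_gaussian_curvature C)"
begin

lemma D_nonzero:
  assumes "(s, t) \<in> D"
  shows "1 + z s t \<noteq> 0" "w s t \<noteq> 0"
proof -
  have s: "s \<in> I" using assms fst_D by force
  show nz: "1 + z s t \<noteq> 0"
  proof
    assume "1 + z s t = 0"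
    then have "ff_E C s t * ff_G C s t - (ff_F C s t)\<^sup>2 = 0" using area[OF s, of t] by simp
    then show False using regular_D assms unfolding regular_on_def by blast
  qed
  show "w s t \<noteq> 0"
  proof
    assume "w s t = 0"
    then have "sf_e C s t * sf_g C s t - (sf_f C s t)\<^sup>2 = 0"
      unfolding sf_products[OF s nz] eg_f_eq[OF s] by simp
    then show False using nondegenerate_D assms unfolding II_nondegenerate_on_def by blast
  qed
qed

text \<open>Since \<open>e g\<close> does not vanish on an entire interval of \<open>t\<close>, a sufficiently short interval lies in one region.\<close>

lemma slice_region:
  assumes s: "s \<in> I"
  obtains a b l where "a < b" "l = 0 \<or> l = 1" "\<And>t. t \<in> {a<..<b} \<Longrightarrow> (s, t) \<in> D \<and> region l s t"
proof -
  from s fst_D obtain t0 where t0: "(s, t0) \<in> D" by force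
  from open_prod_elim[OF open_D t0] obtain A B where
    AB: "open B" "(s, t0) \<in> A \<times> B" "A \<times> B \<subseteq> D" by metis
  then obtain \<delta> where \<delta>: "\<delta> > 0" "ball t0 \<delta> \<subseteq> B"
    unfolding open_contains_ball by blast
  have inD: "(s, t) \<in> D" if "t \<in> {t0 - \<delta><..<t0 + \<delta>}" for t
  proof -
    have "t \<in> ball t0 \<delta>" using that by (auto simp: dist_real_def)
    then show ?thesis using \<delta>(2) AB by blast
  qed
  have "t0 - \<delta> < t0 + \<delta>" using \<delta>(1) by simp
  from definite_somewhere[OF s this] obtain t1 where
    t1: "t1 \<in> {t0 - \<delta><..<t0 + \<delta>}" "w s t1 + (y s t1)\<^sup>2 \<noteq> 0" by blast
  define l :: real where "l = (if w s t1 + (y s t1)\<^sup>2 > 0 then 0 else 1)"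
  have reg: "region l s t1"
    using t1 D_nonzero(1)[OF inD[OF t1(1)]] by (auto simp: region_def l_def)
  have "eventually (\<lambda>t. t \<in> {t0 - \<delta><..<t0 + \<delta>}) (nhds t1)"
    by (rule eventually_nhds_in_open) (use t1 in auto)
  with eventually_region_t[OF reg]
  have "eventually (\<lambda>t. (s, t) \<in> D \<and> region l s t) (nhds t1)"
    by eventually_elim (use inD in blast)
  then obtain d where d: "d > 0" "\<And>t. dist t t1 < d \<Longrightarrow> (s, t) \<in> D \<and> region l s t"
    unfolding eventually_nhds_metric by blast
  show thesis
  proof
    show "t1 - d < t1 + d" using d(1) by simp
    show "l = 0 \<or> l = 1" by (simp add: l_def)
    show "(s, t) \<in> D \<and> region l s t" if "t \<in> {t1 - d<..<t1 + d}" for t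
      using that by (intro d(2)) (auto simp: dist_real_def)
  qed
qed

lemma jacobi_parts_vanish:
  assumes s: "s \<in> I"
  obtains l where "l = 0 \<or> l = 1" "odd_part l s = 0" "even_part l s = 0"
  | "(r1 s)\<^sup>2 = 1/2" "\<omega> s = 1/2"
proof -
  from slice_region[OF s] obtain a b l where ab: "a < b" and l: "l = 0 \<or> l = 1"
    and reg: "\<And>t. t \<in> {a<..<b} \<Longrightarrow> (s, t) \<in> D \<and> region l s t" by metis
  show thesis
  proof (cases "\<exists>t\<in>{a<..<b}. J l s t \<noteq> 0")
    case True
    then obtain t1 where t1: "t1 \<in> {a<..<b}" "J l s t1 \<noteq> 0" by blast
    have "eventually (\<lambda>t. t \<in> {a<..<b}) (nhds t1)"
      by (rule eventually_nhds_in_open) (use t1 in auto)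
    with eventually_sgn_eq[OF DERIV_isCont[OF J_deriv_t] t1(2)]
    have "eventually (\<lambda>t. t \<in> {a<..<b} \<and> J l s t \<noteq> 0) (nhds t1)"
      by eventually_elim (use t1(2) in \<open>auto simp: sgn_if split: if_splits\<close>)
    then obtain d where d: "d > 0" "\<And>t. dist t t1 < d \<Longrightarrow> t \<in> {a<..<b} \<and> J l s t \<noteq> 0"
      unfolding eventually_nhds_metric by blast
    have less: "t1 - d < t1 + d" using d(1) by simp
    have zero: "poly (odd_part l s) (\<nu> s * cos t - \<omega> s)
        + \<nu> s * sin t * poly (even_part l s) (\<nu> s * cos t - \<omega> s) = 0"
      if "t \<in> {t1 - d<..<t1 + d}" for t
    proof -
      have "dist t t1 < d" using that by (auto simp: dist_real_def)
      from d(2)[OF this] have t: "(s, t) \<in> D" "region l s t" "J l s t \<noteq> 0" using reg by auto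
      have "(\<bar>sf_e C s t * sf_g C s t\<bar> - (sf_f C s t)\<^sup>2)\<^sup>2 \<noteq> 0"
        unfolding sf_products[OF s region_nonzero(1)[OF t(2)]] abs_eg_f_eq[OF s t(2)]
        using t(3) p_nonzero[OF s] by simp
      then have "(s, t) \<in> second_gaussian_curvature_domain D C"
        using t(1) by (simp add: second_gaussian_curvature_domain_def)
      with weingarten_D have "jacobi_function (gaussian_curvature C) (second_gaussian_curvature C) s t = 0"
        unfolding weingarten_on_def by blast
      from jacobi_polynomial_surface[OF s t(2,3) this] show ?thesis by (simp add: z_def S_def)
    qed
    from affine_trig_poly_eq_0[OF less \<nu>_nonzero[OF s] zero] l that(1) show thesis by blast
  next
    case False
    have "(a + b) / 2 \<in> {a<..<b}" using ab by simp
    with reg have "(s, (a + b) / 2) \<in> D" by blast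
    from D_nonzero(2)[OF this] False \<open>(a + b) / 2 \<in> {a<..<b}\<close> have "l \<noteq> 0"
      by (fastforce simp: J_def)
    with l have "l = 1" by simp
    with False J_vanishing_slice[OF s ab] that(2) show thesis by blast
  qed
qed

text \<open>If \<open>r' \<noteq> 0\<close> somewhere, the preceding coefficients apply on an open set of \<open>s\<close>, from which the exceptional
configuration \<open>r'\<^sup>2 = \<omega> = 1/2\<close> has been removed. This set is nonempty: on an open set of exceptional
parameters \<open>r'\<close> would be constant, against \<open>\<omega> \<noteq> 0\<close>.\<close>

lemma r1_zero:
  assumes "s \<in> I"
  shows "r1 s = 0"
proof (rule ccontr)
  assume nz: "r1 s \<noteq> 0"
  define W where "W = I \<inter> r1 -` (- {0})"
  define V where "V = W \<inter> ((I \<inter> (\<lambda>s. (r1 s)\<^sup>2) -` (- {1/2})) \<union> (I \<inter> \<omega> -` (- {1/2})))"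
  have c1: "continuous_on I r1"
    using DERIV_isCont[OF r1_deriv'] by (intro continuous_at_imp_continuous_on ballI)
  have c2: "continuous_on I \<omega>"
    using DERIV_isCont[OF \<omega>_deriv] by (intro continuous_at_imp_continuous_on ballI)
  have c3: "continuous_on I (\<lambda>s. (r1 s)\<^sup>2)" using c1 by (intro continuous_intros)
  have W: "open W" unfolding W_def by (rule continuous_open_preimage[OF c1 open_I]) auto
  have V: "open V" unfolding V_def
    by (intro open_Int open_Un W continuous_open_preimage[OF c3 open_I] continuous_open_preimage[OF c2 open_I]) auto
  have sW: "s \<in> W" using assms nz by (simp add: W_def)
  have "\<exists>s0. s0 \<in> V"
  proof (rule ccontr)
    assume "\<nexists>s0. s0 \<in> V"
    then have half: "(r1 u)\<^sup>2 = 1/2 \<and> \<omega> u = 1/2" if "u \<in> W" for u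
      using that by (auto simp: V_def W_def)
    have "((\<lambda>u. (r1 u)\<^sup>2) has_real_derivative 0) (at s)"
      by (rule has_field_derivative_transform_within_open[OF DERIV_const[of "1/2"] W sW])
        (simp add: half)
    moreover have "((\<lambda>u. (r1 u)\<^sup>2) has_real_derivative 2 * r1 s * r2 s) (at s)"
      by (auto intro!: derivative_eq_intros r1_deriv' assms)
    ultimately have "2 * r1 s * r2 s = 0" using DERIV_unique by blast
    then show False
      using nz half[OF sW] p_nonzero[OF assms] r_nonzero[OF assms] by (simp add: r2_def)
  qed
  then obtain s0 where s0: "s0 \<in> V" ..
  have VI: "V \<subseteq> I" by (auto simp: V_def W_def)
  have parts: "odd_part 1 u = 0 \<and> even_part 1 u = 0" if "u \<in> V" for u
  proof -
    have u: "u \<in> I" "r1 u \<noteq> 0" "\<not> ((r1 u)\<^sup>2 = 1/2 \<and> \<omega> u = 1/2)"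
      using that by (auto simp: V_def W_def)
    from jacobi_parts_vanish[OF u(1)] show ?thesis
    proof cases
      case (1 l)
      moreover have "l \<noteq> 0" using even_part_coeff_definite[of u] 1 u(2) r_nonzero[OF u(1)] by auto
      ultimately show ?thesis by blast
    next
      case 2
      with u(3) show ?thesis by blast
    qed
  qed
  have r1_nz: "r1 u \<noteq> 0" if "u \<in> V" for u using that by (auto simp: V_def W_def)
  have \<tau>0: "\<tau> u = 0" if "u \<in> V" for u
  proof -
    have "r1 u / r u * j 1 u = 0"
      using odd_part_coeff parts[OF that] by blast
    then show ?thesis using r1_nz[OF that] r_nonzero VI that by (auto simp: j_def)
  qed
  show False
    using no_indefinite_family[OF V VI s0 r1_nz \<tau>0] parts by blast
qed

lemma \<nu>1_zero:
  assumes s: "s \<in> I"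
  shows "\<nu>1 s = 0"
  using jacobi_parts_vanish[OF s]
proof cases
  case (1 l)
  then show ?thesis using even_part_coeff_tube[OF r1_zero s] by blast
next
  case 2
  with r1_zero[OF s] show ?thesis by simp
qed

end

section \<open>Constant radius and curvature\<close>

lemma times_differentiable_on_SucE:
  assumes "times_differentiable_on (Suc n) S f"
  obtains f' where "\<And>x. x \<in> S \<Longrightarrow> (f has_vector_derivative f' x) (at x)" "times_differentiable_on n S f'"
  using assms by auto

lemma times_differentiable_on_deriv2E:
  fixes f :: "real \<Rightarrow> real"
  assumes "times_differentiable_on 2 S f"
  obtains f' f'' where "\<And>x. x \<in> S \<Longrightarrow> (f has_real_derivative f' x) (at x)"
    "\<And>x. x \<in> S \<Longrightarrow> (f' has_real_derivative f'' x) (at x)"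
proof -
  from assms have "times_differentiable_on (Suc (Suc 0)) S f" by (simp add: numeral_2_eq_2)
  then obtain f' where f': "\<And>x. x \<in> S \<Longrightarrow> (f has_vector_derivative f' x) (at x)"
    "times_differentiable_on (Suc 0) S f'" using times_differentiable_on_SucE by metis
  from f'(2) obtain f'' where "\<And>x. x \<in> S \<Longrightarrow> (f' has_vector_derivative f'' x) (at x)"
    using times_differentiable_on_SucE by metis
  with f'(1) show thesis
    by (intro that[of f' f'']) (simp_all add: has_real_derivative_iff_has_vector_derivative)
qed

lemma constant_on_interval:
  fixes f :: "real \<Rightarrow> 'a::real_normed_vector"
  assumes "is_interval I" "\<And>s. s \<in> I \<Longrightarrow> (f has_vector_derivative 0) (at s)"
  obtains c where "\<And>s. s \<in> I \<Longrightarrow> f s = c"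
  using has_vector_derivative_zero_constant[of I f] assms
    has_vector_derivative_at_within is_interval_convex_1 by metis

text \<open>The torsion is defined as the component of \<open>N'\<close> along \<open>B\<close>; orthonormality gives the other two components.\<close>

lemma frenet_torsion:
  fixes T N :: "real \<Rightarrow> real^3"
  assumes I: "open I"
    and T: "\<And>s. s \<in> I \<Longrightarrow> (T has_vector_derivative \<kappa> s *\<^sub>R N s) (at s)"
    and N: "\<And>s. s \<in> I \<Longrightarrow> (N has_vector_derivative N1 s) (at s)"
    and TT: "\<And>s. s \<in> I \<Longrightarrow> T s \<bullet> T s = 1" and NN: "\<And>s. s \<in> I \<Longrightarrow> N s \<bullet> N s = 1"
    and TN: "\<And>s. s \<in> I \<Longrightarrow> T s \<bullet> N s = 0"
    and B: "\<And>s. s \<in> I \<Longrightarrow> B s = cross3 (T s) (N s)" and s: "s \<in> I"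
  shows "N1 s = - \<kappa> s *\<^sub>R T s + (N1 s \<bullet> B s) *\<^sub>R B s"
    and "(B has_vector_derivative - (N1 s \<bullet> B s) *\<^sub>R N s) (at s)"
proof -
  have const: "(X has_vector_derivative x) (at s) \<Longrightarrow> (\<And>u. u \<in> I \<Longrightarrow> X u = c) \<Longrightarrow> x = 0"
    for X :: "real \<Rightarrow> real" and x c
    using vector_derivative_eq_on_open[OF I s _ has_vector_derivative_const] vector_derivative_at by metis
  have "N s \<bullet> N1 s + N1 s \<bullet> N s = 0"
    by (rule const[OF bounded_bilinear.has_vector_derivative[OF bounded_bilinear_inner N[OF s] N[OF s]] NN])
  then have N1N: "N1 s \<bullet> N s = 0" by (simp add: inner_commute)
  have "T s \<bullet> N1 s + (\<kappa> s *\<^sub>R N s) \<bullet> N s = 0"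
    by (rule const[OF bounded_bilinear.has_vector_derivative[OF bounded_bilinear_inner T[OF s] N[OF s]] TN])
  then have N1T: "N1 s \<bullet> T s = - \<kappa> s" using NN[OF s] by (simp add: inner_commute)
  show N1: "N1 s = - \<kappa> s *\<^sub>R T s + (N1 s \<bullet> B s) *\<^sub>R B s"
    using orthonormal_frame(6)[OF TT[OF s] NN[OF s] TN[OF s], of "N1 s"]
    unfolding N1N N1T B[OF s, symmetric] by simp
  have TB: "cross3 (T s) (B s) = - N s"
    using orthonormal_frame(3)[OF TT[OF s] NN[OF s] TN[OF s]] cross_skew unfolding B[OF s] by metis
  have "cross3 (T s) (N1 s) + cross3 (\<kappa> s *\<^sub>R N s) (N s) = - (N1 s \<bullet> B s) *\<^sub>R N s"
    by (subst N1, simp only: cross_add_right cross_mult_left cross_mult_right cross_refl TB) simp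
  with bounded_bilinear.has_vector_derivative[OF bounded_bilinear_cross3 T[OF s] N[OF s]]
  have "((\<lambda>u. cross3 (T u) (N u)) has_vector_derivative - (N1 s \<bullet> B s) *\<^sub>R N s) (at s)" by simp
  then show "(B has_vector_derivative - (N1 s \<bullet> B s) *\<^sub>R N s) (at s)"
    by (rule has_vector_derivative_transform_within_open[OF _ I s]) (simp add: B)
qed

lemma straight_line_if_curvature_zero:
  assumes canal: "canal_surface I \<alpha> r T N B \<kappa> C" and \<kappa>: "\<And>s. s \<in> I \<Longrightarrow> \<kappa> s = 0"
  shows "straight_line_on I \<alpha>"
proof -
  have I: "open I" "is_interval I" and sm: "smooth_on_interval I \<alpha>" and fr: "frenet_frame I \<alpha> T N B \<kappa>"
    using canal by (auto simp: canal_surface_def)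
  have "times_differentiable_on (Suc (Suc 0)) I \<alpha>"
    using times_differentiable_on_iterated_derivative[OF sm, of _ 0] by simp
  then obtain \<alpha>1 where \<alpha>1: "\<And>s. s \<in> I \<Longrightarrow> (\<alpha> has_vector_derivative \<alpha>1 s) (at s)"
    and "times_differentiable_on (Suc 0) I \<alpha>1" using times_differentiable_on_SucE by metis
  then obtain \<alpha>2 where \<alpha>2: "\<And>s. s \<in> I \<Longrightarrow> (\<alpha>1 has_vector_derivative \<alpha>2 s) (at s)"
    by (auto elim: times_differentiable_on_SucE)
  have T: "T s = \<alpha>1 s" if "s \<in> I" for s
    using fr that vector_derivative_at[OF \<alpha>1[OF that]] by (simp add: frenet_frame_def)
  have "\<alpha>2 s = 0" if "s \<in> I" for s
    using fr that \<kappa>[OF that] vector_derivative_eq_on_open[OF I(1) that T \<alpha>2[OF that]]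
    by (simp add: frenet_frame_def)
  then obtain v where v: "\<And>s. s \<in> I \<Longrightarrow> \<alpha>1 s = v"
    using constant_on_interval[OF I(2), of \<alpha>1] \<alpha>2 by metis
  have "((\<lambda>s. \<alpha> s - s *\<^sub>R v) has_vector_derivative 0) (at s)" if "s \<in> I" for s
    using has_vector_derivative_diff[OF \<alpha>1[OF that]
        has_vector_derivative_scaleR[OF DERIV_ident has_vector_derivative_const[of v]]] v[OF that] by simp
  then obtain a where "\<And>s. s \<in> I \<Longrightarrow> \<alpha> s - s *\<^sub>R v = a"
    using constant_on_interval[OF I(2), of "\<lambda>s. \<alpha> s - s *\<^sub>R v"] by metis
  then have "\<alpha> s = a + s *\<^sub>R v" if "s \<in> I" for s using that by (metis diff_add_cancel)
  then show ?thesis unfolding straight_line_on_def by blast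
qed

text \<open>Where \<open>\<bar>r'\<bar> = 1\<close>, the characteristic circle shrinks to a point, so \<open>C\<^sub>t = 0\<close> and the surface is singular.\<close>

lemma radius_slope_less:
  assumes C: "\<And>s t. s \<in> I \<Longrightarrow> C s t = \<alpha> s - (r s * r1 s) *\<^sub>R T s
      - (\<epsilon> * r s * sqrt (1 - (r1 s)\<^sup>2) * cos t) *\<^sub>R N s + (\<epsilon> * r s * sqrt (1 - (r1 s)\<^sup>2) * sin t) *\<^sub>R B s"
    and dom: "fst ` D = I" and regular: "regular_on D C" and s: "s \<in> I" and le: "\<bar>r1 s\<bar> \<le> 1"
  shows "(r1 s)\<^sup>2 < 1"
proof (rule ccontr)
  assume "\<not> (r1 s)\<^sup>2 < 1"
  moreover have "(r1 s)\<^sup>2 \<le> 1" using le by (simp add: abs_square_le_1)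
  ultimately have "(r1 s)\<^sup>2 = 1" by simp
  then have "(\<lambda>v. C s v) = (\<lambda>v. \<alpha> s - (r s * r1 s) *\<^sub>R T s)" using C[OF s] by auto
  then have "partial_t C s t = 0" for t
    unfolding partial_t_def by (simp add: vector_derivative_at)
  then have "ff_E C s t * ff_G C s t - (ff_F C s t)\<^sup>2 = 0" for t
    by (simp add: ff_F_def ff_G_def)
  moreover obtain t where "(s, t) \<in> D" using dom s by force
  ultimately show False using regular unfolding regular_on_def by blast
qed

text \<open>It remains to recognize the scalar data of the surface as a profile: the derivatives of \<open>\<kappa>\<close>, \<open>\<tau>\<close>, \<open>q\<close>, \<open>\<nu>\<close>
and \<open>\<omega>\<close> exist because \<open>\<alpha>\<close> and \<open>r\<close> are smooth.\<close>

lemma radius_and_curvature_constant: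
  assumes canal: "canal_surface I \<alpha> r T N B \<kappa> C"
    and dom: "open D" "fst ` D = I"
    and regular: "regular_on D C"
    and nondegenerate: "II_nondegenerate_on D C"
    and weingarten: "weingarten_on (second_gaussian_curvature_domain D C)
                       (gaussian_curvature C) (second_gaussian_curvature C)"
    and curved: "\<And>s. s \<in> I \<Longrightarrow> \<kappa> s \<noteq> 0 \<and> N s = (1 / \<kappa> s) *\<^sub>R vector_derivative T (at s)
          \<and> B s = cross3 (T s) (N s)"
  obtains r0 \<kappa>0 where "\<And>s. s \<in> I \<Longrightarrow> r s = r0" "\<And>s. s \<in> I \<Longrightarrow> \<kappa> s = \<kappa>0"
proof -
  have I: "open I" "is_interval I" and sm: "smooth_on_interval I \<alpha>" "smooth_on_interval I r"
    and fr: "frenet_frame I \<alpha> T N B \<kappa>" and r: "\<And>s. s \<in> I \<Longrightarrow> r s > 0 \<and> \<bar>deriv r s\<bar> \<le> 1"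
    using canal by (auto simp: canal_surface_def)
  define D1 :: "nat \<Rightarrow> (real \<Rightarrow> real^3) \<Rightarrow> real \<Rightarrow> real^3"
    where "D1 k = ((\<lambda>g u. vector_derivative g (at u)) ^^ k)" for k
  define E1 :: "nat \<Rightarrow> (real \<Rightarrow> real) \<Rightarrow> real \<Rightarrow> real"
    where "E1 k = ((\<lambda>g u. vector_derivative g (at u)) ^^ k)" for k
  have D1: "(D1 k \<alpha> has_vector_derivative D1 (Suc k) \<alpha> s) (at s)" if "s \<in> I" for k s
    using sm(1) that by (auto simp: smooth_on_interval_def D1_def vector_derivative_works)
  have E1: "(E1 k r has_real_derivative E1 (Suc k) r s) (at s)" if "s \<in> I" for k s
    using sm(2) that
    by (auto simp: smooth_on_interval_def E1_def vector_derivative_works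
        has_real_derivative_iff_has_vector_derivative)
  have tdD: "times_differentiable_on n I (D1 k \<alpha>)" for n k
    unfolding D1_def by (rule times_differentiable_on_iterated_derivative[OF sm(1)])
  have tdE: "times_differentiable_on n I (E1 k r)" for n k
    unfolding E1_def by (rule times_differentiable_on_iterated_derivative[OF sm(2)])
  define r1 r2 r3 where "r1 = E1 1 r" and "r2 = E1 2 r" and "r3 = E1 3 r"
  have r_derivs: "(r has_real_derivative r1 s) (at s)" "(r1 has_real_derivative r2 s) (at s)"
    "(r2 has_real_derivative r3 s) (at s)" if "s \<in> I" for s
    using E1[OF that, of 0] E1[OF that, of 1] E1[OF that, of 2]
    by (simp_all add: E1_def r1_def r2_def r3_def eval_nat_numeral)
  have td_r: "times_differentiable_on n I r" "times_differentiable_on n I r1" "times_differentiable_on n I r2" for n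
    using tdE[of n 0] tdE[of n 1] tdE[of n 2] by (simp_all add: r1_def r2_def) (simp add: E1_def)
  have r1_deriv: "deriv r s = r1 s" if "s \<in> I" for s using r_derivs(1)[OF that] by (rule DERIV_imp_deriv)
  from canal obtain \<epsilon> :: real where \<epsilon>: "\<epsilon> = 1 \<or> \<epsilon> = -1"
    and C0: "\<And>s t. s \<in> I \<Longrightarrow> C s t = \<alpha> s - (r s * deriv r s) *\<^sub>R T s
      - (\<epsilon> * r s * sqrt (1 - (deriv r s)\<^sup>2) * cos t) *\<^sub>R N s
      + (\<epsilon> * r s * sqrt (1 - (deriv r s)\<^sup>2) * sin t) *\<^sub>R B s"
    unfolding canal_surface_def Let_def by blast
  have slope: "(r1 s)\<^sup>2 < 1" if "s \<in> I" for s
    by (rule radius_slope_less[where \<epsilon> = \<epsilon>, OF _ dom(2) regular that])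
      (use C0 r1_deriv r that in auto)
  define p where "p s = 1 - (r1 s)\<^sup>2" for s
  have p_pos: "p s > 0" if "s \<in> I" for s using slope[OF that] by (simp add: p_def)
  have td_p: "times_differentiable_on n I p" for n
  proof -
    have "p = (\<lambda>s. 1 + (-1) * (r1 s * r1 s))" by (auto simp: p_def power2_eq_square)
    then show ?thesis
      by (simp only:) (intro times_differentiable_on_add times_differentiable_on_mult
          times_differentiable_on_const td_r)
  qed
  define q where "q s = \<epsilon> * sqrt (p s)" for s
  have td_q: "times_differentiable_on n I q" for n
    unfolding q_def
    by (intro times_differentiable_on_mult times_differentiable_on_const times_differentiable_on_sqrt td_p p_pos)
  have qq: "q s * q s = 1 - (r1 s)\<^sup>2" if "s \<in> I" for s
    using \<epsilon> p_pos[OF that] by (auto simp: q_def p_def)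
  have q_nz: "q s \<noteq> 0" if "s \<in> I" for s using qq[OF that] slope[OF that] by auto
  obtain q1 q2 where q1: "\<And>s. s \<in> I \<Longrightarrow> (q has_real_derivative q1 s) (at s)"
    and q2: "\<And>s. s \<in> I \<Longrightarrow> (q1 has_real_derivative q2 s) (at s)"
    using times_differentiable_on_deriv2E[OF td_q] by metis
  have qq1: "q s * q1 s = - r1 s * r2 s" if "s \<in> I" for s
  proof -
    have "((\<lambda>s. q s * q s) has_real_derivative 2 * (q s * q1 s)) (at s)"
      by (auto intro!: derivative_eq_intros q1 that)
    moreover have "((\<lambda>s. q s * q s) has_real_derivative - 2 * (r1 s * r2 s)) (at s)"
    proof (rule has_field_derivative_transform_within_open[OF _ I(1) that])
      show "((\<lambda>s. 1 - (r1 s)\<^sup>2) has_real_derivative - 2 * (r1 s * r2 s)) (at s)"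
        by (auto intro!: derivative_eq_intros r_derivs that)
    qed (simp add: qq)
    ultimately have "2 * (q s * q1 s) = - 2 * (r1 s * r2 s)" by (rule DERIV_unique)
    then show ?thesis by algebra
  qed
  have \<alpha>: "(\<alpha> has_vector_derivative D1 1 \<alpha> s) (at s)" if "s \<in> I" for s
    using D1[OF that, of 0] by (simp add: D1_def)
  have fr': "T s = vector_derivative \<alpha> (at s)" "norm (T s) = 1" "\<kappa> s = norm (vector_derivative T (at s))"
    if "s \<in> I" for s using fr[unfolded frenet_frame_def, THEN conjunct1, rule_format, OF that] by blast+
  have T_eq: "T s = D1 1 \<alpha> s" if "s \<in> I" for s
    by (rule trans[OF fr'(1)[OF that] vector_derivative_at[OF \<alpha>[OF that]]])
  have T_D: "(T has_vector_derivative D1 2 \<alpha> s) (at s)" if "s \<in> I" for s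
  proof (rule has_vector_derivative_transform_within_open[OF _ I(1) that])
    show "(D1 1 \<alpha> has_vector_derivative D1 2 \<alpha> s) (at s)"
      using D1[OF that, of 1] by (simp add: numeral_2_eq_2)
  qed (simp add: T_eq)
  have \<alpha>_T: "(\<alpha> has_vector_derivative T s) (at s)" if "s \<in> I" for s
    unfolding T_eq[OF that] by (rule \<alpha>[OF that])
  have r_pos: "r s > 0" if "s \<in> I" for s using r[OF that] by simp
  have \<kappa>_eq: "\<kappa> s = sqrt (D1 2 \<alpha> s \<bullet> D1 2 \<alpha> s)" if "s \<in> I" for s
    using fr'(3)[OF that] vector_derivative_at[OF T_D[OF that]] by (simp add: norm_eq_sqrt_inner)
  have \<kappa>_nz: "\<kappa> s \<noteq> 0" and B_eq: "B s = cross3 (T s) (N s)" if "s \<in> I" for s using curved[OF that] by auto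
  have N_eq: "N s = inverse (\<kappa> s) *\<^sub>R D1 2 \<alpha> s" if "s \<in> I" for s
    using curved[OF that] vector_derivative_at[OF T_D[OF that]] by (simp add: divide_inverse)
  have T_deriv: "(T has_vector_derivative \<kappa> s *\<^sub>R N s) (at s)" if "s \<in> I" for s
    using T_D[OF that] \<kappa>_nz[OF that] by (simp add: N_eq[OF that])
  have pos: "D1 2 \<alpha> s \<bullet> D1 2 \<alpha> s > 0" if "s \<in> I" for s
    using \<kappa>_nz[OF that] unfolding \<kappa>_eq[OF that] by auto
  have td_\<kappa>: "times_differentiable_on n I \<kappa>" for n
  proof (rule times_differentiable_on_cong[OF I(1)])
    show "times_differentiable_on n I (\<lambda>s. sqrt (D1 2 \<alpha> s \<bullet> D1 2 \<alpha> s))"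
      by (intro times_differentiable_on_sqrt times_differentiable_on_inner tdD pos)
  qed (simp add: \<kappa>_eq)
  have td_N: "times_differentiable_on n I N" for n
  proof (rule times_differentiable_on_cong[OF I(1)])
    show "times_differentiable_on n I (\<lambda>s. inverse (\<kappa> s) *\<^sub>R D1 2 \<alpha> s)"
      by (intro times_differentiable_on_scaleR times_differentiable_on_inverse td_\<kappa> tdD \<kappa>_nz)
  qed (simp add: N_eq)
  have td_T: "times_differentiable_on n I T" for n
    by (rule times_differentiable_on_cong[OF I(1) _ tdD[of n 1]]) (simp add: T_eq)
  have td_B: "times_differentiable_on n I B" for n
    by (rule times_differentiable_on_cong[OF I(1) _ times_differentiable_on_cross3[OF td_T td_N]])
      (simp add: B_eq)
  obtain N1 where N1: "\<And>s. s \<in> I \<Longrightarrow> (N has_vector_derivative N1 s) (at s)"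
    and td_N1: "times_differentiable_on 2 I N1"
    using times_differentiable_on_SucE[OF td_N] by metis
  have TT: "T s \<bullet> T s = 1" if "s \<in> I" for s using fr'(2)[OF that] by (simp add: norm_eq_1)
  have NN: "N s \<bullet> N s = 1" if "s \<in> I" for s
  proof -
    have "D1 2 \<alpha> s \<bullet> D1 2 \<alpha> s = \<kappa> s * \<kappa> s" by (simp add: \<kappa>_eq[OF that])
    then show ?thesis using \<kappa>_nz[OF that] by (simp add: N_eq[OF that] field_simps)
  qed
  have TN: "T s \<bullet> N s = 0" if "s \<in> I" for s
  proof -
    have "((\<lambda>u. T u \<bullet> T u) has_vector_derivative T s \<bullet> (\<kappa> s *\<^sub>R N s) + (\<kappa> s *\<^sub>R N s) \<bullet> T s) (at s)"
      by (rule bounded_bilinear.has_vector_derivative[OF bounded_bilinear_inner T_deriv[OF that] T_deriv[OF that]])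
    moreover have "vector_derivative (\<lambda>u. T u \<bullet> T u) (at s) = 0"
      by (rule vector_derivative_eq_on_open[OF I(1) that TT has_vector_derivative_const])
    ultimately have "T s \<bullet> (\<kappa> s *\<^sub>R N s) + (\<kappa> s *\<^sub>R N s) \<bullet> T s = 0"
      using vector_derivative_at by metis
    then show ?thesis using \<kappa>_nz[OF that] by (simp add: inner_commute)
  qed
  define \<tau> where "\<tau> s = N1 s \<bullet> B s" for s
  have tors: "N1 s = - \<kappa> s *\<^sub>R T s + \<tau> s *\<^sub>R B s" "(B has_vector_derivative - \<tau> s *\<^sub>R N s) (at s)"
    if "s \<in> I" for s
    unfolding \<tau>_def
    by (rule frenet_torsion[where I = I and T = T and N = N and B = B and \<kappa> = \<kappa> and ?N1.0 = N1];
        (rule I(1) T_deriv N1 TT NN TN B_eq that; assumption?))+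
  have N_deriv: "(N has_vector_derivative - \<kappa> s *\<^sub>R T s + \<tau> s *\<^sub>R B s) (at s)" if "s \<in> I" for s
    using N1[OF that] tors(1)[OF that] by simp
  have td_\<tau>: "times_differentiable_on 2 I \<tau>"
    unfolding \<tau>_def by (intro times_differentiable_on_inner td_N1 td_B)
  obtain \<tau>1 \<tau>2 where \<tau>1: "\<And>s. s \<in> I \<Longrightarrow> (\<tau> has_real_derivative \<tau>1 s) (at s)"
    using times_differentiable_on_deriv2E[OF td_\<tau>] by metis
  obtain \<kappa>1 \<kappa>2 where \<kappa>1: "\<And>s. s \<in> I \<Longrightarrow> (\<kappa> has_real_derivative \<kappa>1 s) (at s)"
    using times_differentiable_on_deriv2E[OF td_\<kappa>] by metis
  have C_eq: "C s t = \<alpha> s - (r s * r1 s) *\<^sub>R T s - (r s * q s * cos t) *\<^sub>R N s + (r s * q s * sin t) *\<^sub>R B s"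
    if "s \<in> I" for s t
    using C0[OF that] by (simp add: r1_deriv[OF that] q_def p_def mult_ac)
  interpret F: framed_canal_surface I \<alpha> T N B r r1 r2 r3 q q1 q2 \<kappa> \<kappa>1 \<tau> \<tau>1 C
    by unfold_locales
      (rule I(1) \<alpha>_T T_deriv N_deriv tors(2) TT NN TN B_eq r_derivs q1 q2 \<kappa>1 \<tau>1 r_pos q_nz qq qq1 C_eq;
        assumption)+
  define \<nu> where "\<nu> s = r s * q s * \<kappa> s / p s" for s
  define \<omega> where "\<omega> s = r s * r2 s / p s" for s
  have p_nz: "p s \<noteq> 0" if "s \<in> I" for s using p_pos[OF that] by simp
  have "times_differentiable_on 2 I \<nu>" "times_differentiable_on 2 I \<omega>"
    unfolding \<nu>_def \<omega>_def
    by (intro times_differentiable_on_divide times_differentiable_on_mult td_r td_q td_\<kappa> td_p p_nz; assumption)+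
  then obtain \<nu>1 \<nu>2 \<omega>1 \<omega>2 where \<nu>\<omega>: "\<And>s. s \<in> I \<Longrightarrow> (\<nu> has_real_derivative \<nu>1 s) (at s)"
    "\<And>s. s \<in> I \<Longrightarrow> (\<nu>1 has_real_derivative \<nu>2 s) (at s)"
    "\<And>s. s \<in> I \<Longrightarrow> (\<omega> has_real_derivative \<omega>1 s) (at s)"
    "\<And>s. s \<in> I \<Longrightarrow> (\<omega>1 has_real_derivative \<omega>2 s) (at s)"
    by (metis times_differentiable_on_deriv2E)
  interpret Q: canal_profile I r r1 \<tau> \<tau>1 \<nu> \<nu>1 \<nu>2 \<omega> \<omega>1 \<omega>2
  proof
    fix s assume s: "s \<in> I"
    have "(1 - (r1 s)\<^sup>2) * \<omega> s / r s = r2 s"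
      using r[OF s] p_nz[OF s] by (simp add: \<omega>_def p_def[symmetric])
    then show "(r1 has_real_derivative (1 - (r1 s)\<^sup>2) * \<omega> s / r s) (at s)"
      using r_derivs(2)[OF s] by simp
    show "\<nu> s \<noteq> 0" using r[OF s] q_nz[OF s] \<kappa>_nz[OF s] p_nz[OF s] by (simp add: \<nu>_def)
  qed (rule I(1) r_pos slope r_derivs(1) \<tau>1 \<nu>\<omega>; assumption)+
  have forms: "F.QP s t = p s * (1 + Q.z s t)" "sf_e C s t = sgn (1 + Q.z s t) * Q.e s t"
     "sf_f C s t = sgn (1 + Q.z s t) * Q.f s t" "sf_g C s t = sgn (1 + Q.z s t) * Q.g s t"
    if "s \<in> I" for s t
    using F.second_form[OF that, of t]
    by (simp_all add: Q.z_def Q.e_def Q.f_def Q.g_def Q.y_def Q.S_def Q.p_def \<nu>_def \<omega>_def p_def)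
  interpret R: weingarten_profile_surface I r r1 \<tau> \<tau>1 \<nu> \<nu>1 \<nu>2 \<omega> \<omega>1 \<omega>2 C D
  proof
    fix s t assume s: "s \<in> I"
    show "ff_E C s t * ff_G C s t - (ff_F C s t)\<^sup>2 = (r s * Q.p s * (1 + Q.z s t))\<^sup>2"
      unfolding F.first_form[OF s] forms(1)[OF s] by (simp add: Q.p_def p_def mult.assoc)
  qed (rule forms(2-4) dom regular nondegenerate weingarten; assumption)+
  have "(r has_vector_derivative 0) (at s)" "(\<nu> has_vector_derivative 0) (at s)" if "s \<in> I" for s
    using r_derivs(1)[OF that] \<nu>\<omega>(1)[OF that] R.r1_zero[OF that] R.\<nu>1_zero[OF that]
    by (simp_all add: has_real_derivative_iff_has_vector_derivative)
  then obtain r0 \<nu>0 where r0: "\<And>s. s \<in> I \<Longrightarrow> r s = r0" and \<nu>0: "\<And>s. s \<in> I \<Longrightarrow> \<nu> s = \<nu>0"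
    using constant_on_interval[OF I(2), of r] constant_on_interval[OF I(2), of \<nu>] by metis
  have "\<kappa> s = \<nu>0 / (r0 * \<epsilon>)" if "s \<in> I" for s
    using \<nu>0[OF that] r0[OF that] r[OF that] R.r1_zero[OF that] \<epsilon>
    by (auto simp: \<nu>_def q_def p_def field_simps)
  with r0 show thesis by (rule that)
qed

theorem theorem2p3:
  fixes I :: "real set" and D :: "(real \<times> real) set"
    and \<alpha> T N B :: "real \<Rightarrow> real^3" and r \<kappa> :: "real \<Rightarrow> real"
    and C :: "real \<Rightarrow> real \<Rightarrow> real^3"
  assumes canal: "canal_surface I \<alpha> r T N B \<kappa> C"
    and dom: "open D" "fst ` D = I"
    and regular: "regular_on D C"
    and nondegenerate: "II_nondegenerate_on D C"
    and weingarten: "weingarten_on (second_gaussian_curvature_domain D C)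
                       (gaussian_curvature C) (second_gaussian_curvature C)"
  shows "straight_line_on I \<alpha>
    \<or> (\<exists>c1 c2 c3. c1 \<noteq> 1 \<and> c1 \<noteq> -1 \<and>
          (\<forall>s\<in>I. r s = c1 * s + c2) \<and> (\<forall>s\<in>I. \<kappa> s = c3 / root 3 (r s)))
    \<or> ((\<exists>c. \<forall>s\<in>I. r s = c) \<and> cylindrical_helix_on I \<alpha>)"
proof -
  have "frenet_frame I \<alpha> T N B \<kappa>" using canal by (auto simp: canal_surface_def)
  then consider (line) "\<forall>s\<in>I. \<kappa> s = 0"
    | (curved) "\<forall>s\<in>I. \<kappa> s \<noteq> 0 \<and> N s = (1 / \<kappa> s) *\<^sub>R vector_derivative T (at s)
          \<and> B s = cross3 (T s) (N s)"
    unfolding frenet_frame_def by blast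
  then show ?thesis
  proof cases
    case line
    then show ?thesis using straight_line_if_curvature_zero[OF canal] by blast
  next
    case curved
    then obtain r0 \<kappa>0 where c: "\<And>s. s \<in> I \<Longrightarrow> r s = r0" "\<And>s. s \<in> I \<Longrightarrow> \<kappa> s = \<kappa>0"
      using radius_and_curvature_constant[OF canal dom regular nondegenerate weingarten] by metis
    have r_pos: "r s > 0" if "s \<in> I" for s using canal that by (simp add: canal_surface_def)
    have "\<kappa> s = \<kappa>0 * root 3 r0 / root 3 (r s)" if "s \<in> I" for s
      using c[OF that] r_pos[OF that] by simp
    with c(1) have "\<exists>c1 c2 c3. c1 \<noteq> 1 \<and> c1 \<noteq> -1 \<and>
          (\<forall>s\<in>I. r s = c1 * s + c2) \<and> (\<forall>s\<in>I. \<kappa> s = c3 / root 3 (r s))"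
      by (intro exI[of _ 0] exI[of _ r0] exI[of _ "\<kappa>0 * root 3 r0"]) auto
    then show ?thesis by blast
  qed
qed

end
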